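(* Let $\mathcal{A}$ be a compact set of real $d\times d$ matrices, all of which are Hurwitz, and let dwell times $m(A)>0$, $A\in\mathcal{A}$, with $\inf_{A\in\mathcal{A}} m(A)>0$, be given. Consider the linear switching system $\dot{x}(t)=A(t)x(t)$ with control set $\mathcal{A}$, in which every switching interval of each regime $A\in\mathcal{A}$ has length at least $m(A)$. Then for every subset $\mathcal{J}\subset\mathcal{A}$, if the system is $\mathcal{J}$-stable, then it is stable.
   Context: A matrix is Hurwitz if all its eigenvalues have negative real parts. Switching system. A trajectory is a solution $x:[0,\infty)\to\mathbb{R}^d$ of $\dot{x}(t)=A(t)x(t)$, $x(0)=x_0$, for some $x_0\in\mathbb{R}^d$ and some switching law $A(\cdot):[0,\infty)\to\mathcal{A}$. Under the dwell time restriction the switching law is piecewise constant. A switching interval is a segment between two consecutive switching points, i.e. a maximal interval on which the law is constant (the first interval starts at $0$; if there is a last switching point, or no switching point, the last interval is unbounded and has length $+\infty$). The value of $A(\cdot)$ on the interval is called its regime. Only switching laws in which each switching interval of a regime $A$ has length at least $m(A)$ are considered. Stability. The system is stable if all its trajectories (subject to the dwell time restriction) tend to zero as $t\to\infty$. For $\mathcal{J}\subset\mathcal{A}$, the system is $\mathcal{J}$-stable if all those trajectories tend to zero for which, for every $A\in\mathcal{J}$, all switching intervals of the regime $A$ have length at most $m(A)+T_{cut}(A)$ (no upper restriction is imposed on the regimes $A\notin\mathcal{J}$). The number $T_{cut}(A)$. Let $A$ be a Hurwitz $d\times d$ matrix and $x_0\in\mathbb{R}^d$ a generic point, i.e. one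 that does not belong to any proper invariant subspace of $A$. Put $x(t)=e^{tA}x_0$ and, for $M\subset\mathbb{R}^d$, ${\rm co}_s M={\rm co}(M\cup(-M))$ (symmetrized convex hull). Let $G(t_1,t_2)={\rm co}_s\{x(t): t\in[t_1,t_2]\}$. A number $T\ge 0$ is a cut tail point of $A$ if for every $t>T$ the point $x(t)$ belongs to the interior of $G(0,T)$. The set of cut tail points does not depend on the choice of generic $x_0$, and $T_{cut}(A)$ is its minimal element. If $A$ has no generic point (its minimal polynomial has degree less than $d$), one takes $x_0$ such that the smallest $A$-invariant subspace $L$ containing $x_0$ has dimension equal to the degree of the minimal polynomial of $A$, and applies the definition to the restriction of $A$ to $L$ (interiors being taken in $L$). *)

theory Defs
  imports "HOL-Analysis.Analysis" "HOL-Computational_Algebra.Polynomial"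
begin

section \<open>Matrices\<close>

definition hurwitz :: "real^'n^'n \<Rightarrow> bool" where
  "hurwitz A \<longleftrightarrow>
     (\<forall>(z::complex) v. v \<noteq> 0 \<and> map_matrix complex_of_real A *v v = z *s v \<longrightarrow> Re z < 0)"

(* The type class operations * and ^ on vec act entrywise, so matrix powers, the matrix
   exponential and polynomials in a matrix are built from **. *)

definition matpow :: "real^'n^'n \<Rightarrow> nat \<Rightarrow> real^'n^'n" where
  "matpow A k = ((\<lambda>B. A ** B) ^^ k) (mat 1)"

definition matexp :: "real^'n^'n \<Rightarrow> real^'n^'n" where
  "matexp A = (\<Sum>k. matpow A k /\<^sub>R fact k)"

definition poly_mat :: "real poly \<Rightarrow> real^'n^'n \<Rightarrow> real^'n^'n" where
  "poly_mat p A = (\<Sum>i\<le>degree p. coeff p i *\<^sub>R matpow A i)"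

definition min_poly :: "real^'n^'n \<Rightarrow> real poly" where
  "min_poly A = (THE p. lead_coeff p = 1 \<and> poly_mat p A = 0 \<and>
     (\<forall>q. q \<noteq> 0 \<and> poly_mat q A = 0 \<longrightarrow> degree p \<le> degree q))"

definition invariant_subspace :: "real^'n^'n \<Rightarrow> (real^'n) set \<Rightarrow> bool" where
  "invariant_subspace A V \<longleftrightarrow> subspace V \<and> (\<forall>v\<in>V. A *v v \<in> V)"

definition generic_point :: "real^'n^'n \<Rightarrow> real^'n \<Rightarrow> bool" where
  "generic_point A x \<longleftrightarrow> (\<forall>V. invariant_subspace A V \<and> V \<noteq> UNIV \<longrightarrow> x \<notin> V)"

text \<open>The smallest invariant subspace containing \<open>x\<close>; it is the whole space iff \<open>x\<close> is generic.\<close>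

definition cyclic_subspace :: "real^'n^'n \<Rightarrow> real^'n \<Rightarrow> (real^'n) set" where
  "cyclic_subspace A x = invariant_subspace A hull {x}"


section \<open>The cut tail time\<close>

definition sym_convex_hull :: "(real^'n) set \<Rightarrow> (real^'n) set" where
  "sym_convex_hull M = convex hull (M \<union> uminus ` M)"

definition orbit_hull :: "real^'n^'n \<Rightarrow> real^'n \<Rightarrow> real \<Rightarrow> real \<Rightarrow> (real^'n) set" where
  "orbit_hull A x t1 t2 = sym_convex_hull ((\<lambda>t. matexp (t *\<^sub>R A) *v x) ` {t1..t2})"

text \<open>The points from which cut tail points are computed: the generic ones if there are any.\<close>

definition base_point :: "real^'n^'n \<Rightarrow> real^'n \<Rightarrow> bool" where
  "base_point A x \<longleftrightarrow>
     (if \<exists>y. generic_point A y then generic_point A x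
      else dim (cyclic_subspace A x) = degree (min_poly A))"

text \<open>The interior is taken in the cyclic subspace of \<open>x\<close>, hence is the ordinary interior
  when \<open>x\<close> is generic. For \<open>T = 0\<close> this differs from the relative interior, which would be
  taken in the line spanned by \<open>x\<close>.\<close>

definition cut_tail_point :: "real^'n^'n \<Rightarrow> real^'n \<Rightarrow> real \<Rightarrow> bool" where
  "cut_tail_point A x T \<longleftrightarrow> 0 \<le> T \<and>
     (\<forall>t>T. matexp (t *\<^sub>R A) *v x \<in> top_of_set (cyclic_subspace A x) interior_of orbit_hull A x 0 T)"

text \<open>For Hurwitz \<open>A\<close> the set of cut tail points is the same for all base points and has a
  minimum.\<close>

definition T_cut :: "real^'n^'n \<Rightarrow> real" where
  "T_cut A = (LEAST T. \<exists>x. base_point A x \<and> cut_tail_point A x T)"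


section \<open>Switching laws\<close>

text \<open>A law is a function of time of which only the values on \<open>[0, \<infinity>)\<close> matter.\<close>

definition switching_points :: "(real \<Rightarrow> 'a) \<Rightarrow> real set" where
  "switching_points \<sigma> = {t. 0 < t \<and> \<not> (\<forall>\<^sub>F s in nhds t. \<sigma> s = \<sigma> t)}"

text \<open>The value at a switching point is by convention the one taken right after it. It has no
  influence on the trajectories, and with this choice the maximal intervals of constancy are
  exactly the intervals \<open>[a, b)\<close> between consecutive switching points.\<close>

definition piecewise_constant :: "(real \<Rightarrow> 'a) \<Rightarrow> bool" where
  "piecewise_constant \<sigma> \<longleftrightarrow>
     (\<forall>T. finite (switching_points \<sigma> \<inter> {0..T})) \<and>
     (\<forall>t\<ge>0. \<forall>\<^sub>F s in at_right t. \<sigma> s = \<sigma> t)"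

text \<open>\<open>[a, b)\<close> is a switching interval, with \<open>b = \<infinity>\<close> for an unbounded last interval. Its regime
  is \<open>\<sigma> a\<close>.\<close>

definition switching_interval :: "(real \<Rightarrow> 'a) \<Rightarrow> real \<Rightarrow> ereal \<Rightarrow> bool" where
  "switching_interval \<sigma> a b \<longleftrightarrow>
     ereal a < b \<and>
     a \<in> insert 0 (switching_points \<sigma>) \<and>
     b \<in> insert \<infinity> (ereal ` switching_points \<sigma>) \<and>
     (\<forall>s\<in>switching_points \<sigma>. \<not> (a < s \<and> ereal s < b))"

definition switching_law ::
    "(real^'n^'n) set \<Rightarrow> (real^'n^'n \<Rightarrow> real) \<Rightarrow> (real \<Rightarrow> real^'n^'n) \<Rightarrow> bool" where
  "switching_law \<A> m \<sigma> \<longleftrightarrow>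
     (\<forall>t\<ge>0. \<sigma> t \<in> \<A>) \<and> piecewise_constant \<sigma> \<and>
     (\<forall>a b. switching_interval \<sigma> a b \<longrightarrow> ereal (m (\<sigma> a)) \<le> b - ereal a)"

definition trajectory :: "(real \<Rightarrow> real^'n^'n) \<Rightarrow> (real \<Rightarrow> real^'n) \<Rightarrow> bool" where
  "trajectory \<sigma> x \<longleftrightarrow>
     continuous_on {0..} x \<and>
     (\<forall>t\<ge>0. t \<notin> switching_points \<sigma> \<longrightarrow>
        (x has_vector_derivative (\<sigma> t *v x t)) (at t within {0..}))"


section \<open>Stability\<close>

definition switching_stable :: "(real^'n^'n) set \<Rightarrow> (real^'n^'n \<Rightarrow> real) \<Rightarrow> bool" where
  "switching_stable \<A> m \<longleftrightarrow>
     (\<forall>\<sigma> x. switching_law \<A> m \<sigma> \<and> trajectory \<sigma> x \<longrightarrow> (x \<longlongrightarrow> 0) at_top)"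

definition switching_J_stable ::
    "(real^'n^'n) set \<Rightarrow> (real^'n^'n) set \<Rightarrow> (real^'n^'n \<Rightarrow> real) \<Rightarrow> bool" where
  "switching_J_stable J \<A> m \<longleftrightarrow>
     (\<forall>\<sigma> x. switching_law \<A> m \<sigma> \<and> trajectory \<sigma> x \<and>
        (\<forall>a b. switching_interval \<sigma> a b \<and> \<sigma> a \<in> J \<longrightarrow>
           b - ereal a \<le> ereal (m (\<sigma> a) + T_cut (\<sigma> a)))
        \<longrightarrow> (x \<longlongrightarrow> 0) at_top)"

end

(* After time T_cut(A) the matrix exp(tA) lies in the symmetrised convex hull of the exp(sA) with
  s <= T_cut(A): a base point x is annihilated by no nonzero polynomial in A, so the inclusion of x(t)
  in the hull of the orbit of x lifts to matrices. Hence a seminorm that takes a large value at the end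
  of a switching interval takes a value at least as large for some admissible shorter length.

  Suppose that products of k operators exp(tA), t >= m(A), do not contract for any k. An upper limit
  of normalised maxima of norms over such products is then a nonzero seminorm v with
  v(x) <= sup v(exp(tA) x). Starting from v(x) > c, choose operators that keep v above c. Consecutive
  operators with the same A merge into a longer one; since A is Hurwitz, A has to change at some time,
  and before the change the length can be cut to at most m(A) + T_cut(A) without letting v drop to c.
  This yields a trajectory that is admissible for J-stability and stays away from 0, a contradiction.
  So long products contract uniformly, and all trajectories tend to 0. *)
theory Submission
  imports Defs "HOL-Computational_Algebra.Fundamental_Theorem_Algebra" "HOL-Computational_Algebra.Polynomial_Factorial" "HOL-Computational_Algebra.Field_as_Ring"
begin

section \<open>The matrix exponential\<close>

text \<open>Only a seminorm is to be expected: common invariant subspaces may force v to vanish in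
  some directions. The operators exp(tA), t >= m(A), need not form a closed set, as m is an
  arbitrary function with positive infimum, so suprema need not be attained; every selection
  therefore keeps a strict inequality v > c below the initial value. Symmetrised hulls fit because v
  is convex and even.

  The regime has to change between consecutive intervals because switching intervals are maximal
  intervals of constancy: two adjacent ones with the same matrix would count as one, possibly longer
  than m(A) + T_cut(A). For the same reason an operator is shortened only after its successor has
  been chosen, and the loss is measured by v composed with that successor, so that the choice
  survives.

  Compactness supplies one constant C that bounds exp(tA) for all t >= 0 and all A in the set. It
  makes the normalised maxima finite, turns v > c into a lower bound for the states, and controls
  the unfinished interval at the current time.\<close>

lemma matrix_mult_scaleR [simp]:
  fixes A :: "real^'n^'m" and B :: "real^'p^'n"
  shows "(c *\<^sub>R A) ** B = c *\<^sub>R (A ** B)" "A ** (c *\<^sub>R B) = c *\<^sub>R (A ** B)"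
  by (simp_all add: scalar_matrix_assoc matrix_scalar_ac)

lemma matrix_mult_add_distrib_right:
  fixes A B :: "real^'n^'m" and C :: "real^'p^'n"
  shows "(A + B) ** C = A ** C + B ** C"
  by (simp add: matrix_matrix_mult_def vec_eq_iff distrib_right sum.distrib)

lemma bounded_bilinear_matrix_mult:
  "bounded_bilinear ((**) :: real^'n^'m \<Rightarrow> real^'p^'n \<Rightarrow> real^'p^'m)"
  unfolding bilinear_conv_bounded_bilinear [symmetric] bilinear_def
  by (auto intro!: linearI simp: matrix_add_ldistrib matrix_mult_add_distrib_right)

lemma matrix_vector_mult_uminus:
  fixes A :: "real^'n^'m"
  shows "(- A) *v x = - (A *v x)"
  by (simp add: matrix_vector_mult_def vec_eq_iff sum_negf)

lemma bounded_bilinear_matrix_vector_mult: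
  "bounded_bilinear ((*v) :: real^'n^'m \<Rightarrow> real^'n \<Rightarrow> real^'m)"
  unfolding bilinear_conv_bounded_bilinear [symmetric] bilinear_def
  by (auto intro!: linearI simp: matrix_vector_right_distrib matrix_vector_mult_add_rdistrib
      scaleR_matrix_vector_assoc matrix_vector_mult_scaleR)

lemmas bounded_linear_matrix_mult_left =
  bounded_bilinear.bounded_linear_left [OF bounded_bilinear_matrix_mult]

lemmas bounded_linear_matrix_mult_right =
  bounded_bilinear.bounded_linear_right [OF bounded_bilinear_matrix_mult]

lemmas bounded_linear_matrix_vector_mult_left =
  bounded_bilinear.bounded_linear_left [OF bounded_bilinear_matrix_vector_mult]

lemmas has_vector_derivative_matrix_vector_mult =
  bounded_bilinear.has_vector_derivative [OF bounded_bilinear_matrix_vector_mult]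

lemma matpow_0 [simp]: "matpow A 0 = mat 1"
  by (simp add: matpow_def)

lemma matpow_Suc: "matpow A (Suc k) = A ** matpow A k"
  by (simp add: matpow_def)

lemma matpow_commute: "matpow A k ** A = A ** matpow A k"
  by (induction k) (simp_all add: matpow_Suc matrix_mul_assoc [symmetric])

lemma matpow_scaleR: "matpow (t *\<^sub>R A) k = t ^ k *\<^sub>R matpow A k"
  by (induction k)
    (simp_all add: matpow_Suc mult.commute)

text \<open>The submultiplicative quantity is \<open>onorm\<close>, but convergence is measured in
  the Euclidean norm of the space of matrices; entrywise bounds lead from one to the other.\<close>

lemma norm_matrix_entries_le:
  fixes A :: "real^'n^'m"
  assumes "\<And>i j. \<bar>A $ i $ j\<bar> \<le> b"
  shows "norm A \<le> real CARD('m) * (real CARD('n) * b)"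
proof -
  have "norm (A $ i) \<le> real CARD('n) * b" for i
  proof -
    have "norm (A $ i) \<le> (\<Sum>j\<in>UNIV. \<bar>A $ i $ j\<bar>)"
      by (rule norm_le_l1_cart)
    also have "\<dots> \<le> (\<Sum>j\<in>(UNIV :: 'n set). b)"
      by (intro sum_mono assms)
    finally show ?thesis by simp
  qed
  moreover have "norm A \<le> (\<Sum>i\<in>UNIV. norm (A $ i))"
    unfolding norm_vec_def by (rule L2_set_le_sum) simp
  ultimately have "norm A \<le> (\<Sum>i\<in>(UNIV :: 'm set). real CARD('n) * b)"
    by (meson order_trans sum_mono)
  then show ?thesis by simp
qed

lemma onorm_matpow_le:
  fixes A :: "real^'n^'n"
  shows "onorm ((*v) (matpow A k)) \<le> onorm ((*v) A) ^ k"
proof (induction k)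
  case 0
  then show ?case by (simp add: onorm_id_le [unfolded id_def])
next
  case (Suc k)
  have "onorm ((*v) (matpow A (Suc k))) = onorm ((*v) A \<circ> (*v) (matpow A k))"
    by (simp add: matpow_Suc o_def matrix_vector_mul_assoc)
  also have "\<dots> \<le> onorm ((*v) A) * onorm ((*v) (matpow A k))"
    by (intro onorm_compose matrix_vector_mul_bounded_linear)
  also have "\<dots> \<le> onorm ((*v) A) * onorm ((*v) A) ^ k"
    by (intro mult_left_mono Suc onorm_pos_le matrix_vector_mul_bounded_linear)
  finally show ?case by simp
qed

lemma matpow_entry_le:
  fixes A :: "real^'n^'n"
  shows "\<bar>matpow A k $ i $ j\<bar> \<le> onorm ((*v) A) ^ k"
  using matrix_component_le_onorm onorm_matpow_le by (rule order_trans)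

lemma matexp_summable:
  fixes A :: "real^'n^'n"
  shows "summable (\<lambda>k. matpow A k /\<^sub>R fact k)"
proof (rule summable_comparison_test')
  let ?K = "onorm ((*v) A)"
  show "summable (\<lambda>k. real CARD('n) * (real CARD('n) * (inverse (fact k) * ?K ^ k)))"
    by (intro summable_mult summable_exp)
  show "norm (matpow A k /\<^sub>R fact k) \<le> real CARD('n) * (real CARD('n) * (inverse (fact k) * ?K ^ k))" for k
    using matpow_entry_le [of A k]
    by (intro norm_matrix_entries_le) (simp add: abs_mult mult_left_mono)
qed

text \<open>Each entry is a scalar power series in \<open>t\<close>, to which termwise
  differentiation of real power series applies.\<close>

lemma matexp_entry:
  fixes A :: "real^'n^'n"
  shows "matexp (t *\<^sub>R A) $ i $ j = (\<Sum>k. (matpow A k $ i $ j / fact k) * t ^ k)"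
    and "summable (\<lambda>k. (matpow A k $ i $ j / fact k) * t ^ k)"
proof -
  have bl: "bounded_linear (\<lambda>M :: real^'n^'n. M $ i $ j)"
    by (intro bounded_linear_compose [OF bounded_linear_vec_nth] bounded_linear_vec_nth)
  have eq: "(matpow (t *\<^sub>R A) k /\<^sub>R fact k) $ i $ j = (matpow A k $ i $ j / fact k) * t ^ k" for k
    by (simp add: matpow_scaleR field_simps)
  show "matexp (t *\<^sub>R A) $ i $ j = (\<Sum>k. (matpow A k $ i $ j / fact k) * t ^ k)"
    unfolding matexp_def using bounded_linear.suminf [OF bl matexp_summable, of "t *\<^sub>R A"]
    by (simp only: eq)
  show "summable (\<lambda>k. (matpow A k $ i $ j / fact k) * t ^ k)"
    using bounded_linear.summable [OF bl matexp_summable, of "t *\<^sub>R A"] by (simp only: eq)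
qed

lemma matexp_0 [simp]: "matexp (0 :: real^'n^'n) = mat 1"
proof -
  have "matpow (0 :: real^'n^'n) k /\<^sub>R fact k = (if k = 0 then mat 1 else 0)" for k
    by (cases k) (simp_all add: matpow_Suc)
  then show ?thesis
    unfolding matexp_def by (simp only:) (subst suminf_finite [of "{0}"], auto)
qed

lemma matrix_mult_matexp:
  fixes A B :: "real^'n^'n"
  shows "B ** matexp A = (\<Sum>k. (B ** matpow A k) /\<^sub>R fact k)"
    and "matexp A ** B = (\<Sum>k. (matpow A k ** B) /\<^sub>R fact k)"
  unfolding matexp_def
   apply (subst bounded_linear.suminf [OF bounded_linear_matrix_mult_right matexp_summable])
   apply simp
  apply (subst bounded_linear.suminf [OF bounded_linear_matrix_mult_left matexp_summable])
  apply simp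
  done

lemma matexp_commute:
  fixes A :: "real^'n^'n"
  shows "matexp (t *\<^sub>R A) ** A = A ** matexp (t *\<^sub>R A)"
  by (simp add: matrix_mult_matexp matpow_scaleR matpow_commute)

lemma matexp_has_vector_derivative:
  fixes A :: "real^'n^'n"
  shows "((\<lambda>t. matexp (t *\<^sub>R A)) has_vector_derivative A ** matexp (t *\<^sub>R A)) (at t within S)"
proof -
  have "((\<lambda>t. matexp (t *\<^sub>R A) $ i $ j) has_vector_derivative (A ** matexp (t *\<^sub>R A)) $ i $ j) (at t)" for i j
  proof -
    have "diffs (\<lambda>k. matpow A k $ i $ j / fact k) = (\<lambda>k. (A ** matpow A k) $ i $ j / fact k)"
      by (simp add: diffs_def matpow_Suc del: of_nat_Suc fun_eq_iff)
    moreover have "(A ** matexp (t *\<^sub>R A)) $ i $ j = (\<Sum>k. ((A ** matpow A k) $ i $ j / fact k) * t ^ k)"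
    proof -
      have bl: "bounded_linear (\<lambda>M :: real^'n^'n. (A ** M) $ i $ j)"
        by (intro bounded_linear_compose [OF bounded_linear_vec_nth]
            bounded_linear_compose [OF bounded_linear_vec_nth] bounded_linear_matrix_mult_right)
      show ?thesis
        unfolding matexp_def bounded_linear.suminf [OF bl matexp_summable]
        by (simp add: matpow_scaleR field_simps)
    qed
    ultimately show ?thesis
      using termdiffs_strong_converges_everywhere
          [of "\<lambda>k. matpow A k $ i $ j / fact k" t, OF matexp_entry(2)]
      by (simp add: matexp_entry(1) has_real_derivative_iff_has_vector_derivative)
  qed
  \<comment> \<open>The entrywise derivatives are reassembled by expanding the matrix in the
    elementary matrices \<open>axis i (axis j 1)\<close>.\<close>
  then have "((\<lambda>t. \<Sum>i\<in>UNIV. \<Sum>j\<in>UNIV. matexp (t *\<^sub>R A) $ i $ j *\<^sub>R axis i (axis j (1 :: real)))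
      has_vector_derivative (\<Sum>i\<in>UNIV. \<Sum>j\<in>UNIV. (A ** matexp (t *\<^sub>R A)) $ i $ j *\<^sub>R axis i (axis j (1 :: real)))) (at t)"
    by (intro has_vector_derivative_sum)
      (auto intro!: bounded_linear.has_vector_derivative [OF bounded_linear_scaleR_left])
  moreover have "(\<Sum>i\<in>UNIV. \<Sum>j\<in>UNIV. M $ i $ j *\<^sub>R axis i (axis j (1 :: real))) = M" for M :: "real^'n^'n"
  proof -
    have "(\<Sum>j\<in>UNIV. M $ i $ j *\<^sub>R axis i (axis j (1 :: real)) $ k $ l) = (if k = i then M $ k $ l else 0)" for i k l
      by (cases "k = i") (simp_all add: axis_def if_distrib [of "\<lambda>z. _ * z"] cong: if_cong)
    then show ?thesis by (simp add: vec_eq_iff)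
  qed
  ultimately have "((\<lambda>t. matexp (t *\<^sub>R A)) has_vector_derivative A ** matexp (t *\<^sub>R A)) (at t)"
    by (simp only:)
  then show ?thesis
    by (rule has_vector_derivative_at_within)
qed

lemma matexp_minus_has_vector_derivative:
  fixes A :: "real^'n^'n"
  shows "((\<lambda>t. matexp ((c - t) *\<^sub>R A)) has_vector_derivative - (matexp ((c - t) *\<^sub>R A) ** A)) (at t within S)"
proof -
  have "((\<lambda>t. c - t) has_vector_derivative - 1) (at t within S)"
    by (auto intro!: derivative_eq_intros)
  from vector_diff_chain_within [OF this matexp_has_vector_derivative]
  show ?thesis by (simp add: o_def matexp_commute)
qed

text \<open>The product of \<open>matexp ((b - t) *\<^sub>R A)\<close> with \<open>x t\<close> has
  zero derivative off \<open>K\<close>. The finite set \<open>K\<close> accommodates switching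
  points, where a trajectory need not satisfy the equation.\<close>

lemma matexp_solution_unique:
  fixes A :: "real^'n^'n" and x :: "real \<Rightarrow> real^'n"
  assumes "finite K" "continuous_on {a..b} x" "a \<le> b"
    and "\<And>t. t \<in> {a..b} - K \<Longrightarrow> (x has_vector_derivative A *v x t) (at t within {a..b})"
  shows "x b = matexp ((b - a) *\<^sub>R A) *v x a"
proof -
  let ?f = "\<lambda>t. matexp ((b - t) *\<^sub>R A) *v x t"
  have "?f b = ?f a"
  proof (rule has_derivative_zero_unique_strong_interval [OF \<open>finite K\<close> _ refl])
    have "continuous_on {a..b} (\<lambda>t. matexp ((b - t) *\<^sub>R A))"
      using matexp_minus_has_vector_derivative has_vector_derivative_continuous
      by (fastforce simp: continuous_on_eq_continuous_within)
    then show "continuous_on {a..b} ?f"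
      by (intro bounded_bilinear.continuous_on [OF bounded_bilinear_matrix_vector_mult] assms)
    show "(?f has_derivative (\<lambda>h. 0)) (at t within {a..b})" if "t \<in> {a..b} - K" for t
      using has_vector_derivative_matrix_vector_mult
        [OF matexp_minus_has_vector_derivative [of b A t "{a..b}"] assms(4) [OF that]]
      by (simp add: has_vector_derivative_def matrix_vector_mul_assoc
          matrix_vector_mult_uminus)
    show "b \<in> {a..b}" using assms by simp
  qed
  then show ?thesis by simp
qed

text \<open>Applied to a vector v, the orbit exp(rA) v solves the equation on [t, s + t], and
  uniqueness determines its value at the right end. The sign of \<open>s\<close> orients this
  interval.\<close>

lemma matexp_add:
  fixes A :: "real^'n^'n"
  assumes "0 \<le> s"
  shows "matexp ((s + t) *\<^sub>R A) = matexp (s *\<^sub>R A) ** matexp (t *\<^sub>R A)"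
proof -
  have "matexp ((s + t) *\<^sub>R A) *v v = matexp (s *\<^sub>R A) *v (matexp (t *\<^sub>R A) *v v)" for v
  proof -
    have der: "((\<lambda>r. matexp (r *\<^sub>R A) *v v) has_vector_derivative A *v (matexp (r *\<^sub>R A) *v v)) (at r within S)" for r S
      using bounded_linear.has_vector_derivative
        [OF bounded_linear_matrix_vector_mult_left [of v] matexp_has_vector_derivative [of A r S]]
      by (simp add: matrix_vector_mul_assoc)
    have "continuous_on {t..s + t} (\<lambda>r. matexp (r *\<^sub>R A) *v v)"
      using der has_vector_derivative_continuous
      by (fastforce simp: continuous_on_eq_continuous_within)
    from matexp_solution_unique [OF finite.emptyI this _ der] assms show ?thesis by simp
  qed
  then show ?thesis
    by (simp add: matrix_eq matrix_vector_mul_assoc)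
qed

section \<open>Decay for Hurwitz matrices\<close>

definition cvec :: "real^'n \<Rightarrow> complex^'n" where
  "cvec x = (\<chi> i. complex_of_real (x $ i))"

lemma cvec_nth [simp]: "cvec x $ i = complex_of_real (x $ i)"
  by (simp add: cvec_def)

lemma map_matrix_mult_cvec: "map_matrix complex_of_real A *v cvec x = cvec (A *v x)"
  by (simp add: vec_eq_iff matrix_vector_mult_def)

lemma matrix_vector_mult_sum_right:
  fixes M :: "'a::comm_semiring_1^'n^'m"
  shows "M *v (\<Sum>i\<in>S. f i) = (\<Sum>i\<in>S. M *v f i)"
  by (simp add: vec_eq_iff matrix_vector_mult_def sum_distrib_left) (auto intro: sum.swap)

text \<open>The vector p(A) x for a complex polynomial p and real A and x. Only real powers of
  \<open>A\<close> occur; complex numbers enter through the coefficients.\<close>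

definition cpoly_mult :: "real^'n^'n \<Rightarrow> complex poly \<Rightarrow> real^'n \<Rightarrow> complex^'n" where
  "cpoly_mult A p x = (\<Sum>i\<le>degree p. coeff p i *s cvec (matpow A i *v x))"

lemma cpoly_mult_ge_degree:
  assumes "degree p \<le> n"
  shows "cpoly_mult A p x = (\<Sum>i\<le>n. coeff p i *s cvec (matpow A i *v x))"
  unfolding cpoly_mult_def using assms
  by (intro sum.mono_neutral_left) (auto simp: coeff_eq_0)

lemma cpoly_mult_smult: "cpoly_mult A (smult c p) x = c *s cpoly_mult A p x"
  by (subst cpoly_mult_ge_degree [of _ "degree p"])
    (auto simp: cpoly_mult_def vec_eq_iff sum_distrib_left mult_ac)

lemma cpoly_mult_linear_factor:
  "cpoly_mult A ([:- z, 1:] * p) x = map_matrix complex_of_real A *v cpoly_mult A p x - z *s cpoly_mult A p x"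
proof -
  let ?n = "degree p" and ?v = "\<lambda>i. cvec (matpow A i *v x)"
  have eq: "[:- z, 1:] * p = pCons 0 p - smult z p"
    by simp
  have "cpoly_mult A ([:- z, 1:] * p) x = (\<Sum>i\<le>Suc ?n. coeff ([:- z, 1:] * p) i *s ?v i)"
    by (rule cpoly_mult_ge_degree) (use degree_mult_le [of "[:- z, 1:]" p] in simp)
  also have "\<dots> = (\<Sum>i\<le>Suc ?n. coeff (pCons 0 p) i *s ?v i) - (\<Sum>i\<le>Suc ?n. (z * coeff p i) *s ?v i)"
    unfolding eq by (simp add: sum_subtractf [symmetric] vector_sub_rdistrib del: sum.atMost_Suc)
  also have "(\<Sum>i\<le>Suc ?n. (z * coeff p i) *s ?v i) = z *s cpoly_mult A p x"
    by (subst cpoly_mult_ge_degree [of p "Suc ?n"])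
      (simp_all add: vec_eq_iff sum_distrib_left mult_ac del: sum.atMost_Suc)
  also have "(\<Sum>i\<le>Suc ?n. coeff (pCons 0 p) i *s ?v i) = (\<Sum>i\<le>?n. coeff p i *s ?v (Suc i))"
    by (subst sum.atMost_Suc_shift) simp
  also have "\<dots> = map_matrix complex_of_real A *v cpoly_mult A p x"
    unfolding cpoly_mult_def
    by (simp add: matpow_Suc matrix_vector_mul_assoc [symmetric] map_matrix_mult_cvec [symmetric]
        matrix_vector_mult_sum_right vector_scalar_commute)
  finally show ?thesis .
qed

text \<open>Stated for sequences because powers of a matrix may coincide; a repetition is itself a
  relation with coefficients 1 and -1.\<close>

lemma linear_dependent_sequence:
  fixes f :: "nat \<Rightarrow> 'a::euclidean_space"
  obtains c where "\<exists>i\<le>DIM('a). c i \<noteq> 0" "(\<Sum>i\<le>DIM('a). c i *\<^sub>R f i) = 0"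
proof (cases "inj_on f {..DIM('a)}")
  case True
  then have "card (f ` {..DIM('a)}) > DIM('a)"
    by (simp add: card_image)
  then have "dependent (f ` {..DIM('a)})"
    using independent_bound not_less by blast
  then obtain u where u: "\<exists>i\<le>DIM('a). u (f i) \<noteq> 0" "(\<Sum>v\<in>f ` {..DIM('a)}. u v *\<^sub>R v) = 0"
    by (auto simp: dependent_finite)
  with True show ?thesis
    by (intro that [of "\<lambda>i. u (f i)"]) (auto simp: sum.reindex)
next
  case False
  then obtain i j where ij: "i \<le> DIM('a)" "j \<le> DIM('a)" "i \<noteq> j" "f i = f j"
    by (auto simp: inj_on_def)
  let ?c = "\<lambda>k. if k = i then 1 else if k = j then - 1 else (0 :: real)"
  have "(\<Sum>k\<le>DIM('a). ?c k *\<^sub>R f k) = (\<Sum>k\<in>{i, j}. ?c k *\<^sub>R f k)"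
    using ij by (intro sum.mono_neutral_right) auto
  with ij show ?thesis
    by (intro that [of ?c]) auto
qed

text \<open>Variation of constants: exp(-tz) f(t) has derivative exp(-tz) g(t), so once
  \<open>g\<close> is small it grows at most like a small multiple of exp(at) with a = -Re
  z.\<close>

lemma decay_perturbed_scalar:
  fixes f g :: "real \<Rightarrow> complex"
  assumes der: "\<And>t. (f has_vector_derivative z * f t + g t) (at t)"
    and g: "(g \<longlongrightarrow> 0) at_top" and z: "Re z < 0"
  shows "(f \<longlongrightarrow> 0) at_top"
proof (rule tendstoI)
  fix e :: real assume e: "e > 0"
  define a where "a = - Re z"
  have a: "a > 0" using z by (simp add: a_def)
  \<comment> \<open>Chosen so that \<delta> / a = e / 2, which is what the perturbation contributes
    after multiplication by exp(-at).\<close>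
  define \<delta> where "\<delta> = e / 2 * a"
  have "\<delta> > 0" using e a by (simp add: \<delta>_def)
  then obtain T where T: "\<And>t. t \<ge> T \<Longrightarrow> norm (g t) < \<delta>"
    using tendstoD [OF g] by (auto simp: eventually_at_top_linorder)
  define h where "h t = exp (- (of_real t * z)) * f t" for t
  define \<phi> where "\<phi> t = \<delta> / a * exp (a * t)" for t
  have dh: "(h has_vector_derivative exp (- (of_real t * z)) * g t) (at t)" for t
    unfolding h_def
    by (rule derivative_eq_intros has_vector_derivative_real_field der refl)+
      (simp add: algebra_simps scaleR_conv_of_real)
  have d\<phi>: "(\<phi> has_vector_derivative \<delta> * exp (a * t)) (at t)" for t
    unfolding \<phi>_def has_real_derivative_iff_has_vector_derivative [symmetric]
    using a by (auto intro!: derivative_eq_intros)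
  have ne: "norm (exp (- (of_real t * z))) = exp (a * t)" for t
    by (simp add: a_def algebra_simps)
  have "norm (h t - h T) \<le> \<phi> t - \<phi> T" if "t > T" for t
  proof (rule differentiable_bound_general [OF that, where \<phi> = \<phi> and f = h and
        \<phi>' = "\<lambda>t. \<delta> * exp (a * t)" and f' = "\<lambda>t. exp (- (of_real t * z)) * g t"])
    show "continuous_on {T..t} \<phi>" "continuous_on {T..t} h"
      using dh d\<phi> by (meson continuous_at_imp_continuous_on has_vector_derivative_continuous)+
    show "norm (exp (- (of_real s * z)) * g s) \<le> \<delta> * exp (a * s)" if "T < s" for s
      using mult_left_mono [OF less_imp_le [OF T [of s]], of "exp (a * s)"] that
      unfolding norm_mult ne by (simp add: mult.commute)
  qed (use dh d\<phi> in auto)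
  moreover have "\<phi> T \<ge> 0" using a \<open>\<delta> > 0\<close> by (simp add: \<phi>_def)
  ultimately have h: "norm (h t) \<le> norm (h T) + \<phi> t" if "t > T" for t
    using that norm_triangle_ineq2 [of "h t" "h T"] by fastforce
  have bound: "norm (f t) \<le> exp (- a * t) * norm (h T) + e / 2" if "t > T" for t
  proof -
    have "norm (f t) = exp (- a * t) * norm (h t)"
      unfolding h_def norm_mult ne by (simp add: exp_minus)
    also have "\<dots> \<le> exp (- a * t) * (norm (h T) + \<phi> t)"
      using h [OF that] by simp
    also have "\<dots> = exp (- a * t) * norm (h T) + exp (- a * t) * \<phi> t"
      by (rule distrib_left)
    also have "exp (- a * t) * \<phi> t = e / 2"
      using a by (simp add: \<phi>_def \<delta>_def exp_minus)
    finally show ?thesis .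
  qed
  have "((\<lambda>t. exp (- a * t) * norm (h T)) \<longlongrightarrow> 0) at_top"
    using a by (intro tendsto_mult_left_zero filterlim_compose [OF exp_at_bot]
        filterlim_tendsto_neg_mult_at_bot [OF tendsto_const _ filterlim_ident]) simp
  from tendstoD [OF this, of "e / 2"] have "\<forall>\<^sub>F t in at_top. exp (- a * t) * norm (h T) < e / 2"
    using e by simp
  then show "\<forall>\<^sub>F t in at_top. dist (f t) 0 < e"
    using eventually_gt_at_top [of T]
  proof eventually_elim
    case (elim t)
    with bound [of t] show ?case by simp
  qed
qed

lemma matpow_mult_commute: "matpow A k *v (A *v y) = A *v (matpow A k *v y)"
  by (simp add: matrix_vector_mul_assoc matpow_commute)

text \<open>The number of powers considered exceeds the dimension of the space of matrices, which
  forces a linear relation.\<close>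

lemma annihilating_cpoly:
  fixes A :: "real^'n^'n"
  obtains p where "p \<noteq> 0" "\<And>x. cpoly_mult A p x = 0"
proof -
  let ?d = "DIM(real^'n^'n)"
  obtain c where c: "\<exists>i\<le>?d. c i \<noteq> 0" "(\<Sum>i\<le>?d. c i *\<^sub>R matpow A i) = 0"
    by (rule linear_dependent_sequence)
  define p where "p = Abs_poly (\<lambda>i. if i \<le> ?d then complex_of_real (c i) else 0)"
  have coeff: "coeff p i = (if i \<le> ?d then complex_of_real (c i) else 0)" for i
    unfolding p_def by (subst coeff_Abs_poly [of ?d]) auto
  have deg: "degree p \<le> ?d"
    by (rule degree_le) (simp add: coeff)
  show ?thesis
  proof
    show "p \<noteq> 0"
      using c(1) coeff by (metis coeff_0 of_real_eq_0_iff)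
    fix x
    have "cpoly_mult A p x = (\<Sum>i\<le>?d. complex_of_real (c i) *s cvec (matpow A i *v x))"
      unfolding cpoly_mult_ge_degree [OF deg] by (simp add: coeff)
    also have "\<dots> = cvec ((\<Sum>i\<le>?d. c i *\<^sub>R matpow A i) *v x)"
      by (simp add: vec_eq_iff
          linear_sum [OF bounded_linear.linear [OF bounded_linear_matrix_vector_mult_left]]
          scaleR_matrix_vector_assoc [symmetric])
    finally show "cpoly_mult A p x = 0"
      unfolding c(2) by (simp add: vec_eq_iff)
  qed
qed

lemma matexp_mult_has_vector_derivative:
  fixes A :: "real^'n^'n"
  shows "((\<lambda>t. matexp (t *\<^sub>R A) *v x) has_vector_derivative A *v (matexp (t *\<^sub>R A) *v x)) (at t within S)"
  using bounded_linear.has_vector_derivative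
    [OF bounded_linear_matrix_vector_mult_left [of x] matexp_has_vector_derivative [of A t S]]
  by (simp add: matrix_vector_mul_assoc)

text \<open>If \<open>p\<close> is a polynomial of least degree annihilating \<open>A\<close>, all its roots are eigenvalues. Removing
  the linear factors \<open>X - z\<close> of \<open>p\<close> one by one, \<open>decay_perturbed_scalar\<close> shows that \<open>q(A) exp(tA) x\<close> decays
  for shorter and shorter products \<open>q\<close>, down to \<open>q = 1\<close>.\<close>

lemma hurwitz_matexp_mult_tendsto_0:
  fixes A :: "real^'n^'n"
  assumes "hurwitz A"
  shows "((\<lambda>t. matexp (t *\<^sub>R A) *v x) \<longlongrightarrow> 0) at_top"
proof -
  let ?P = "\<lambda>p. p \<noteq> 0 \<and> (\<forall>x. cpoly_mult A p x = 0)"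
  obtain p0 where "?P p0" using annihilating_cpoly by metis
  then have "?P (arg_min degree ?P) \<and> (\<forall>q. ?P q \<longrightarrow> degree (arg_min degree ?P) \<le> degree q)"
    by (rule arg_min_nat_lemma)
  then obtain p where p: "?P p" and min: "\<And>q. ?P q \<Longrightarrow> degree p \<le> degree q"
    by blast
  obtain root where root: "smult (lead_coeff p) (\<Prod>i<degree p. [:- root i, 1:]) = p"
    by (rule complex_poly_decompose')
  define q where "q k = (\<Prod>i<k. [:- root i, 1:])" for k
  \<comment> \<open>Let \<open>r\<close> be the quotient of \<open>p\<close> by this linear factor.
    Minimality of \<open>p\<close> gives \<open>x\<close> with r(A) x nonzero, and p(A) x = 0 says
    that r(A) x is an eigenvector.\<close>
  have neg: "Re (root i) < 0" if i: "i < degree p" for i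
  proof -
    define r where "r = smult (lead_coeff p) (\<Prod>j\<in>{..<degree p} - {i}. [:- root j, 1:])"
    have "(\<Prod>j<degree p. [:- root j, 1:]) = [:- root i, 1:] * (\<Prod>j\<in>{..<degree p} - {i}. [:- root j, 1:])"
      by (rule prod.remove) (use i in auto)
    then have pr: "p = [:- root i, 1:] * r"
      unfolding r_def mult_smult_right by (metis root)
    have "r \<noteq> 0"
      using p pr mult_zero_right by metis
    moreover from this have "degree ([:- root i, 1:] * r) = Suc (degree r)"
      by (subst degree_mult_eq) auto
    moreover have "degree p = degree ([:- root i, 1:] * r)"
      by (rule arg_cong [OF pr])
    ultimately have "degree r < degree p" by simp
    with min [of r] \<open>r \<noteq> 0\<close> obtain x :: "real^'n" where x: "cpoly_mult A r x \<noteq> 0"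
      by (meson not_less)
    have "map_matrix complex_of_real A *v cpoly_mult A r x = root i *s cpoly_mult A r x"
      using p cpoly_mult_linear_factor [of A "root i" r x, folded pr] by simp
    with x assms show ?thesis unfolding hurwitz_def by blast
  qed
  let ?y = "\<lambda>t. matexp (t *\<^sub>R A) *v x"
  have der: "((\<lambda>t. cpoly_mult A r (?y t) $ j) has_vector_derivative
      (map_matrix complex_of_real A *v cpoly_mult A r (?y t)) $ j) (at t)" for r j t
  proof -
    have entry: "((\<lambda>t. complex_of_real ((M *v ?y t) $ j)) has_vector_derivative complex_of_real ((M *v (A *v ?y t)) $ j)) (at t)" for M :: "real^'n^'n"
      by (intro bounded_linear.has_vector_derivative [OF bounded_linear_of_real]
          bounded_linear.has_vector_derivative [OF bounded_linear_vec_nth]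
          bounded_linear.has_vector_derivative [OF matrix_vector_mul_bounded_linear]
          matexp_mult_has_vector_derivative)
    have "((\<lambda>t. \<Sum>i\<le>degree r. coeff r i * complex_of_real ((matpow A i *v ?y t) $ j)) has_vector_derivative
       (\<Sum>i\<le>degree r. coeff r i * complex_of_real ((matpow A i *v (A *v ?y t)) $ j))) (at t)"
      by (intro has_vector_derivative_sum bounded_linear.has_vector_derivative [OF bounded_linear_mult_right] entry)
    also have "(\<Sum>i\<le>degree r. coeff r i * complex_of_real ((matpow A i *v (A *v ?y t)) $ j))
        = (\<Sum>i\<le>degree r. coeff r i *s (map_matrix complex_of_real A *v cvec (matpow A i *v ?y t))) $ j"
      by (simp add: map_matrix_mult_cvec matpow_mult_commute)
    also have "(\<Sum>i\<le>degree r. coeff r i *s (map_matrix complex_of_real A *v cvec (matpow A i *v ?y t)))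
        = map_matrix complex_of_real A *v cpoly_mult A r (?y t)"
      unfolding cpoly_mult_def
      by (simp add: matrix_vector_mult_sum_right vector_scalar_commute)
    finally show ?thesis by (simp add: cpoly_mult_def)
  qed
  have "((\<lambda>t. cpoly_mult A (q (degree p - k)) (?y t) $ j) \<longlongrightarrow> 0) at_top" if "k \<le> degree p" for k j
    using that
  proof (induction k)
    case 0
    have "lead_coeff p *s cpoly_mult A (q (degree p)) y = 0" for y
      using p root by (simp add: q_def cpoly_mult_smult [symmetric])
    then have "cpoly_mult A (q (degree p)) y = 0" for y
      using p by simp
    then show ?case by simp
  next
    case (Suc k)
    let ?l = "degree p - Suc k"
    have l: "degree p - k = Suc ?l" "?l < degree p" using Suc.prems by auto
    have q: "q (degree p - k) = [:- root ?l, 1:] * q ?l"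
      unfolding l q_def by (simp add: mult.commute)
    show ?case
    proof (rule decay_perturbed_scalar)
      show "((\<lambda>t. cpoly_mult A (q ?l) (?y t) $ j) has_vector_derivative
         root ?l * cpoly_mult A (q ?l) (?y t) $ j + cpoly_mult A (q (degree p - k)) (?y t) $ j) (at t)" for t
        using der [of "q ?l" j t] unfolding q cpoly_mult_linear_factor by simp
    qed (use Suc neg l in auto)
  qed
  from this [of "degree p"] have "((\<lambda>t. complex_of_real (?y t $ j)) \<longlongrightarrow> 0) at_top" for j
    by (simp add: q_def cpoly_mult_def)
  then show ?thesis
    by (intro vec_tendstoI) (simp add: tendsto_of_real_iff [where c = 0, simplified])
qed


lemma hurwitz_matexp_tendsto_0:
  fixes A :: "real^'n^'n"
  assumes "hurwitz A"
  shows "((\<lambda>t. matexp (t *\<^sub>R A)) \<longlongrightarrow> 0) at_top"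
proof (intro vec_tendstoI)
  fix i j
  have "((\<lambda>t. (matexp (t *\<^sub>R A) *v axis j 1) $ i) \<longlongrightarrow> 0 $ i) at_top"
    by (intro tendsto_vec_nth hurwitz_matexp_mult_tendsto_0 assms)
  then show "((\<lambda>t. matexp (t *\<^sub>R A) $ i $ j) \<longlongrightarrow> 0 $ i $ j) at_top"
    by (simp add: matrix_vector_mul_component inner_axis)
qed

section \<open>Uniform bounds on compact sets of Hurwitz matrices\<close>

lemma onorm_matexp_le:
  fixes A :: "real^'n^'n"
  shows "onorm ((*v) (matexp A)) \<le> exp (onorm ((*v) A))"
proof (rule onorm_le)
  fix x
  let ?K = "onorm ((*v) A)"
  have "norm ((matpow A k /\<^sub>R fact k) *v x) \<le> (inverse (fact k) * ?K ^ k) * norm x" for k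
  proof -
    have "norm (matpow A k *v x) \<le> onorm ((*v) (matpow A k)) * norm x"
      by (rule onorm [OF matrix_vector_mul_bounded_linear])
    also have "\<dots> \<le> ?K ^ k * norm x"
      by (rule mult_right_mono [OF onorm_matpow_le norm_ge_zero])
    finally show ?thesis
      by (simp add: scaleR_matrix_vector_assoc [symmetric] field_simps)
  qed
  from norm_suminf_le [OF this summable_mult2 [OF summable_exp]]
  have "norm (\<Sum>k. (matpow A k /\<^sub>R fact k) *v x) \<le> (\<Sum>k. (inverse (fact k) * ?K ^ k) * norm x)" .
  also have "\<dots> = exp ?K * norm x"
    unfolding exp_def by (subst suminf_mult2 [symmetric, OF summable_exp]) (simp add: field_simps)
  finally show "norm (matexp A *v x) \<le> exp ?K * norm x"
    unfolding matexp_def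
    by (subst bounded_linear.suminf [OF bounded_linear_matrix_vector_mult_left matexp_summable])
qed

lemma onorm_matrix_le_norm:
  obtains c where "c > 0" "\<And>A :: real^'n^'m. onorm ((*v) A) \<le> c * norm A"
proof -
  obtain c where "c > 0" "\<And>(A :: real^'n^'m) x. norm (A *v x) \<le> norm A * norm x * c"
    using bounded_bilinear.pos_bounded [OF bounded_bilinear_matrix_vector_mult] by blast
  then show ?thesis
    by (intro that [of c] onorm_le) (auto simp: mult_ac)
qed

lemma continuous_on_matpow: "continuous_on S (\<lambda>A :: real^'n^'n. matpow A k)"
  by (induction k)
    (auto simp: matpow_Suc intro!: continuous_intros
      bounded_bilinear.continuous_on [OF bounded_bilinear_matrix_mult])

lemma continuous_on_matexp: "continuous_on UNIV (matexp :: real^'n^'n \<Rightarrow> _)"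
proof -
  obtain c where c: "c > 0" "\<And>A :: real^'n^'n. onorm ((*v) A) \<le> c * norm A"
    using onorm_matrix_le_norm by blast
  have "continuous_on (ball 0 r) (matexp :: real^'n^'n \<Rightarrow> _)" for r
    unfolding matexp_def
  proof (rule uniform_limit_theorem [OF _ Weierstrass_m_test])
    show "\<forall>\<^sub>F n in sequentially. continuous_on (ball 0 r) (\<lambda>A :: real^'n^'n. \<Sum>i<n. matpow A i /\<^sub>R fact i)"
      by (intro always_eventually allI continuous_intros continuous_on_matpow)
    show "summable (\<lambda>k. real CARD('n) * (real CARD('n) * (inverse (fact k) * (c * r) ^ k)))"
      by (intro summable_mult summable_exp)
    fix A :: "real^'n^'n" and k assume "A \<in> ball 0 r"
    then have "c * norm A \<le> c * r"
      using c(1) by simp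
    then have "onorm ((*v) A) \<le> c * r"
      using c(2) order_trans by blast
    then have "onorm ((*v) A) ^ k \<le> (c * r) ^ k"
      by (intro power_mono onorm_pos_le matrix_vector_mul_bounded_linear)
    then show "norm (matpow A k /\<^sub>R fact k) \<le> real CARD('n) * (real CARD('n) * (inverse (fact k) * (c * r) ^ k))"
      using order_trans [OF matpow_entry_le] by (intro norm_matrix_entries_le) (simp add: abs_mult)
  qed simp
  then have "continuous (at A) (matexp :: real^'n^'n \<Rightarrow> _)" for A
    by (rule continuous_on_interior [of "ball 0 (norm A + 1)"]) simp
  then show ?thesis by (simp add: continuous_at_imp_continuous_on)
qed

text \<open>Time splits into full periods \<tau>, which do not increase the norm, and a remainder of
  length at most \<tau>, which costs at most the exponential factor.\<close>

lemma matexp_bound_from_period: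
  fixes A :: "real^'n^'n"
  assumes "\<tau> > 0" "onorm ((*v) (matexp (\<tau> *\<^sub>R A))) \<le> 1" "t \<ge> 0"
  shows "norm (matexp (t *\<^sub>R A) *v x) \<le> exp (\<tau> * onorm ((*v) A)) * norm x"
proof -
  have "norm (matexp (t *\<^sub>R A) *v x) \<le> exp (\<tau> * onorm ((*v) A)) * norm x"
    if "0 \<le> t" "t \<le> real k * \<tau>" for k t x
    using that
  proof (induction k arbitrary: t x)
    case 0
    have "onorm ((*v) A) \<ge> 0" by (simp add: onorm_pos_le)
    with 0 assms show ?case by (simp add: mult_le_cancel_right1)
  next
    case (Suc k)
    show ?case
    proof (cases "t \<le> \<tau>")
      case True
      have A0: "onorm ((*v) A) \<ge> 0" by (simp add: onorm_pos_le)
      have "norm (matexp (t *\<^sub>R A) *v x) \<le> onorm ((*v) (matexp (t *\<^sub>R A))) * norm x"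
        by (rule onorm) simp
      also have "\<dots> \<le> exp (onorm ((*v) (t *\<^sub>R A))) * norm x"
        by (intro mult_right_mono onorm_matexp_le) simp
      also have "onorm ((*v) (t *\<^sub>R A)) = t * onorm ((*v) A)"
        using Suc.prems onorm_scaleR [of "(*v) A" t] by (simp add: scaleR_matrix_vector_assoc)
      also have "exp (t * onorm ((*v) A)) * norm x \<le> exp (\<tau> * onorm ((*v) A)) * norm x"
        using True A0 by (intro mult_right_mono) (simp_all add: mult_right_mono)
      finally show ?thesis .
    next
      case False
      have "matexp (t *\<^sub>R A) *v x = matexp ((t - \<tau>) *\<^sub>R A) *v (matexp (\<tau> *\<^sub>R A) *v x)"
        using matexp_add [of "t - \<tau>" \<tau> A] False by (simp add: matrix_vector_mul_assoc)
      also have "norm \<dots> \<le> exp (\<tau> * onorm ((*v) A)) * norm (matexp (\<tau> *\<^sub>R A) *v x)"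
        using False Suc.prems by (intro Suc.IH) (auto simp: algebra_simps)
      also have "norm (matexp (\<tau> *\<^sub>R A) *v x) \<le> 1 * norm x"
        by (rule order_trans [OF onorm mult_right_mono]) (use assms in auto)
      finally show ?thesis by simp
    qed
  qed
  moreover obtain k where "t \<le> real k * \<tau>"
    using reals_Archimedean3 [OF \<open>\<tau> > 0\<close>] less_imp_le by meson
  ultimately show ?thesis using assms by blast
qed

text \<open>A time at which the exponential of one matrix contracts serves a whole neighbourhood.
  Bounding the norm there as well makes the one-period estimate uniform, and finitely many such
  neighbourhoods cover \<open>\<A>\<close>.\<close>

proposition compact_hurwitz_matexp_bounded:
  fixes \<A> :: "(real^'n^'n) set"
  assumes "compact \<A>" "\<And>A. A \<in> \<A> \<Longrightarrow> hurwitz A"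
  obtains C where "C \<ge> 1" "\<And>A t x. A \<in> \<A> \<Longrightarrow> t \<ge> 0 \<Longrightarrow> norm (matexp (t *\<^sub>R A) *v x) \<le> C * norm x"
proof -
  obtain c where c: "c > 0" "\<And>A :: real^'n^'n. onorm ((*v) A) \<le> c * norm A"
    using onorm_matrix_le_norm by blast
  \<comment> \<open>Euclidean norm below 1 / c puts the operator norm below 1, as the one-period
    estimate requires.\<close>
  have "\<exists>\<tau>>0. norm (matexp (\<tau> *\<^sub>R A)) < 1 / c" if "A \<in> \<A>" for A
  proof -
    have "\<forall>\<^sub>F t in at_top. norm (matexp (t *\<^sub>R A)) < 1 / c"
      using tendstoD [OF hurwitz_matexp_tendsto_0 [OF assms(2) [OF that]], of "1 / c"] c by simp
    from eventually_conj [OF this eventually_gt_at_top [of 0]] show ?thesis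
      using eventually_happens' [OF trivial_limit_at_top_linorder] by blast
  qed
  then obtain \<tau> where \<tau>: "\<And>A. A \<in> \<A> \<Longrightarrow> \<tau> A > 0 \<and> norm (matexp (\<tau> A *\<^sub>R A)) < 1 / c"
    by metis
  define U where "U A = {B :: real^'n^'n. norm (matexp (\<tau> A *\<^sub>R B)) < 1 / c} \<inter> {B. norm B < norm A + 1}" for A
  have cont: "continuous_on UNIV (\<lambda>B. matexp (s *\<^sub>R B :: real^'n^'n))" for s
    by (intro continuous_on_compose2 [OF continuous_on_matexp] continuous_intros) auto
  have opn: "open (U A)" for A
    unfolding U_def
    by (intro open_Int open_Collect_less continuous_on_norm continuous_on_id continuous_on_const cont)
  have cov: "\<A> \<subseteq> (\<Union>A\<in>\<A>. U A)"
    using \<tau> by (force simp: U_def)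
  obtain F where F: "F \<subseteq> \<A>" "finite F" "\<A> \<subseteq> (\<Union>A\<in>F. U A)"
    by (rule compactE_image [OF assms(1) opn cov]) auto
  define E where "E A = exp (\<tau> A * (c * (norm A + 1)))" for A
  have bd: "norm (matexp (t *\<^sub>R B) *v x) \<le> E A * norm x" if "A \<in> F" "B \<in> U A" "t \<ge> 0" for A B t x
  proof -
    have \<tau>A: "\<tau> A > 0" using \<tau> F that by blast
    have "onorm ((*v) (matexp (\<tau> A *\<^sub>R B))) \<le> c * norm (matexp (\<tau> A *\<^sub>R B))"
      by (rule c)
    also have "\<dots> \<le> 1"
      using that c by (simp add: U_def field_simps)
    finally have "norm (matexp (t *\<^sub>R B) *v x) \<le> exp (\<tau> A * onorm ((*v) B)) * norm x"
      using \<tau>A that by (intro matexp_bound_from_period)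
    also have "c * norm B \<le> c * (norm A + 1)"
      using c(1) that by (simp add: U_def)
    then have "onorm ((*v) B) \<le> c * (norm A + 1)"
      using c(2) order_trans by blast
    then have "exp (\<tau> A * onorm ((*v) B)) * norm x \<le> E A * norm x"
      using \<tau>A by (simp add: E_def mult_right_mono)
    finally show ?thesis .
  qed
  define C where "C = 1 + (\<Sum>A\<in>F. E A)"
  have Enn: "E A \<ge> 0" for A by (simp add: E_def)
  show ?thesis
  proof (rule that [of C])
    show "C \<ge> 1" unfolding C_def using Enn by (simp add: sum_nonneg)
    fix B t and x :: "real^'n" assume "B \<in> \<A>" "t \<ge> (0 :: real)"
    then obtain A where A: "A \<in> F" "B \<in> U A" using F by blast
    have "E A \<le> C"
      unfolding C_def using member_le_sum [of A F E] A F Enn by (simp add: add_increasing)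
    then have "E A * norm x \<le> C * norm x"
      by (simp add: mult_right_mono)
    with bd [OF A \<open>t \<ge> 0\<close>, of x] show "norm (matexp (t *\<^sub>R B) *v x) \<le> C * norm x"
      by linarith
  qed
qed

section \<open>Polynomials in a matrix and base points\<close>

lemma poly_mat_ge_degree:
  assumes "degree p \<le> n"
  shows "poly_mat p A = (\<Sum>i\<le>n. coeff p i *\<^sub>R matpow A i)"
  unfolding poly_mat_def using assms
  by (intro sum.mono_neutral_left) (auto simp: coeff_eq_0)

lemma poly_mat_add: "poly_mat (p + q) A = poly_mat p A + poly_mat q A"
proof -
  let ?n = "max (degree p) (degree q)"
  have "poly_mat (p + q) A = (\<Sum>i\<le>?n. coeff (p + q) i *\<^sub>R matpow A i)"
    by (rule poly_mat_ge_degree) (rule degree_add_le_max)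
  also have "\<dots> = poly_mat p A + poly_mat q A"
    by (simp add: poly_mat_ge_degree [of p ?n] poly_mat_ge_degree [of q ?n] scaleR_add_left sum.distrib)
  finally show ?thesis .
qed

lemma poly_mat_smult: "poly_mat (smult c p) A = c *\<^sub>R poly_mat p A"
  by (subst poly_mat_ge_degree [of _ "degree p"]) (auto simp: poly_mat_def scaleR_sum_right)

lemma poly_mat_0 [simp]: "poly_mat 0 A = 0"
  by (simp add: poly_mat_def)

lemma poly_mat_diff: "poly_mat (p - q) A = poly_mat p A - poly_mat q A"
  using poly_mat_add [of p "smult (- 1) q" A] poly_mat_smult [of "- 1" q A] by simp

lemma poly_mat_pCons: "poly_mat (pCons a p) A = a *\<^sub>R mat 1 + A ** poly_mat p A"
proof -
  have "poly_mat (pCons a p) A = (\<Sum>i\<le>Suc (degree p). coeff (pCons a p) i *\<^sub>R matpow A i)"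
    by (rule poly_mat_ge_degree) simp
  also have "\<dots> = a *\<^sub>R mat 1 + (\<Sum>i\<le>degree p. A ** (coeff p i *\<^sub>R matpow A i))"
    by (subst sum.atMost_Suc_shift) (simp add: matpow_Suc)
  also have "(\<Sum>i\<le>degree p. A ** (coeff p i *\<^sub>R matpow A i)) = A ** poly_mat p A"
    unfolding poly_mat_def
    by (simp only: linear_sum [OF bounded_linear.linear [OF bounded_linear_matrix_mult_right]])
  finally show ?thesis .
qed

lemma poly_mat_mult: "poly_mat (p * q) A = poly_mat p A ** poly_mat q A"
  by (induction p)
    (simp_all add: poly_mat_add poly_mat_smult poly_mat_pCons matrix_mult_add_distrib_right
      matrix_mul_assoc)

lemma poly_mat_mult_commute: "poly_mat p A ** poly_mat q A = poly_mat q A ** poly_mat p A"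
  by (metis poly_mat_mult mult.commute)

section \<open>The algebra generated by a matrix and its minimal polynomial\<close>

abbreviation matpow_span :: "real^'n^'n \<Rightarrow> (real^'n^'n) set" where
  "matpow_span A \<equiv> span (range (matpow A))"

lemma matpow_conv_poly_mat: "matpow A k = poly_mat (monom 1 k) A"
  by (subst poly_mat_ge_degree [of _ k])
    (auto simp: degree_monom_le if_distrib [of "\<lambda>c. c *\<^sub>R _"] cong: if_cong)

lemma poly_mat_in_matpow_span: "poly_mat p A \<in> matpow_span A"
  unfolding poly_mat_def by (intro span_sum span_scale span_base) simp

lemma matpow_spanE:
  assumes "M \<in> matpow_span A"
  obtains p where "M = poly_mat p A"
proof -
  have "subspace (range (\<lambda>p. poly_mat p A))"
    unfolding subspace_def
    by (auto simp: image_iff) (metis poly_mat_0, metis poly_mat_add, metis poly_mat_smult)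
  moreover have "range (matpow A) \<subseteq> range (\<lambda>p. poly_mat p A)"
    using matpow_conv_poly_mat by blast
  ultimately show ?thesis
    using that assms span_minimal by blast
qed

text \<open>Justifies the \<open>THE\<close>: an annihilating polynomial of least degree can be made
  monic, and the leading terms of two such cancel in their difference, which must then be
  zero.\<close>

lemma min_poly:
  fixes A :: "real^'n^'n"
  shows "lead_coeff (min_poly A) = 1" "poly_mat (min_poly A) A = 0"
    "q \<noteq> 0 \<Longrightarrow> poly_mat q A = 0 \<Longrightarrow> degree (min_poly A) \<le> degree q"
proof -
  let ?d = "DIM(real^'n^'n)"
  let ?P = "\<lambda>p. p \<noteq> 0 \<and> poly_mat p A = 0"
  let ?Q = "\<lambda>p. lead_coeff p = 1 \<and> poly_mat p A = 0 \<and> (\<forall>q. ?P q \<longrightarrow> degree p \<le> degree q)"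
  obtain c where c: "\<exists>i\<le>?d. c i \<noteq> 0" "(\<Sum>i\<le>?d. c i *\<^sub>R matpow A i) = 0"
    by (rule linear_dependent_sequence)
  define p0 where "p0 = Abs_poly (\<lambda>i. if i \<le> ?d then c i else 0)"
  have coeff: "coeff p0 i = (if i \<le> ?d then c i else 0)" for i
    unfolding p0_def by (subst coeff_Abs_poly [of ?d]) auto
  have "degree p0 \<le> ?d"
    by (rule degree_le) (simp add: coeff)
  then have "poly_mat p0 A = 0"
    unfolding c(2) [symmetric] by (subst poly_mat_ge_degree) (auto simp: coeff)
  moreover have "p0 \<noteq> 0"
    using c(1) coeff by (metis coeff_0)
  ultimately have "?P p0" by blast
  then have "?P (arg_min degree ?P) \<and> (\<forall>q. ?P q \<longrightarrow> degree (arg_min degree ?P) \<le> degree q)"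
    by (rule arg_min_nat_lemma)
  then obtain p where p: "?P p" and min: "\<And>q. ?P q \<Longrightarrow> degree p \<le> degree q"
    by blast
  have ex: "?Q (smult (inverse (lead_coeff p)) p)"
    using p min by (simp add: poly_mat_smult)
  have unique: "r = s" if r: "?Q r" and s: "?Q s" for r s
  proof (rule ccontr)
    assume "r \<noteq> s"
    have r0: "r \<noteq> 0" and s0: "s \<noteq> 0"
      using r [THEN conjunct1] s [THEN conjunct1] by auto
    have "degree r \<le> degree s" "degree s \<le> degree r"
      using r s r0 s0 by blast+
    then have deg: "degree r = degree s" by (rule le_antisym)
    have P: "?P (r - s)"
      using r s \<open>r \<noteq> s\<close> by (simp add: poly_mat_diff)
    then have "degree r \<le> degree (r - s)" using r by blast
    moreover have "degree (r - s) \<le> degree r"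
      using degree_diff_le_max [of r s] deg by simp
    ultimately have "degree (r - s) = degree r" by simp
    then have "lead_coeff (r - s) = lead_coeff r - lead_coeff s"
      using deg by (simp only: coeff_diff)
    also have "\<dots> = 1 - 1" by (simp only: r [THEN conjunct1] s [THEN conjunct1])
    finally have "lead_coeff (r - s) = 0" by (simp only: diff_self)
    then have "r - s = 0" by (simp only: leading_coeff_0_iff)
    with P show False by blast
  qed
  have "\<exists>!p. ?Q p"
    by (rule ex_ex1I [OF exI [of ?Q, OF ex] unique])
  then have Q: "?Q (min_poly A)"
    unfolding min_poly_def by (rule theI')
  show "lead_coeff (min_poly A) = 1" "poly_mat (min_poly A) A = 0"
    using Q by (rule conjunct1, rule conjunct1 [OF conjunct2])
  show "degree (min_poly A) \<le> degree q" if "q \<noteq> 0" "poly_mat q A = 0"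
    using Q that by (simp only: simp_thms)
qed

lemma min_poly_nonzero: "min_poly A \<noteq> 0"
  using min_poly(1) [of A] by auto

text \<open>The minimal polynomial is monic, so the power at its degree is a combination of the
  lower ones, whose span is thus closed under multiplication by \<open>A\<close>.\<close>

lemma matpow_span_eq: "matpow_span A = span (matpow A ` {..<degree (min_poly A)})"
proof -
  let ?D = "degree (min_poly A)" and ?S = "span (matpow A ` {..<degree (min_poly A)})"
  have "(\<Sum>i\<le>?D. coeff (min_poly A) i *\<^sub>R matpow A i) = 0"
    using min_poly(2) [of A] by (simp add: poly_mat_def)
  moreover have "{..?D} = insert ?D {..<?D}" by auto
  ultimately have "matpow A ?D = - (\<Sum>i<?D. coeff (min_poly A) i *\<^sub>R matpow A i)"
    using min_poly(1) [of A] by (simp add: eq_neg_iff_add_eq_0)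
  also have "\<dots> \<in> ?S"
    by (intro span_neg span_sum span_scale span_base) auto
  finally have D: "matpow A ?D \<in> ?S" .
  have step: "A ** M \<in> ?S" if "M \<in> ?S" for M
  proof -
    have lin: "linear ((**) A)"
      by (rule bounded_linear.linear [OF bounded_linear_matrix_mult_right])
    have "A ** M \<in> span ((**) A ` matpow A ` {..<?D})"
      using that by (simp add: linear_span_image [OF lin] del: image_image)
    also have "\<dots> \<subseteq> ?S"
    proof (rule span_minimal)
      show "(**) A ` matpow A ` {..<?D} \<subseteq> ?S"
      proof clarsimp
        fix i assume "i < ?D"
        then have "Suc i < ?D \<or> Suc i = ?D" by auto
        then show "A ** matpow A i \<in> ?S"
          unfolding matpow_Suc [symmetric] using D by (auto intro: span_base)
      qed
    qed (rule subspace_span)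
    finally show ?thesis .
  qed
  have "matpow A k \<in> ?S" for k
  proof (induction k)
    case 0
    have "matpow A 0 \<in> ?S" if "0 < ?D"
      using that by (intro span_base imageI) simp
    moreover have "matpow A 0 \<in> ?S" if "?D = 0"
      unfolding that by (rule D [unfolded that])
    ultimately show ?case by blast
  next
    case (Suc k)
    then show ?case using step by (simp add: matpow_Suc)
  qed
  then have "matpow_span A \<subseteq> ?S"
    by (intro span_minimal subspace_span) auto
  moreover have "?S \<subseteq> matpow_span A"
    by (intro span_mono) auto
  ultimately show ?thesis by blast
qed

text \<open>A relation between the lower powers would be an annihilating polynomial of degree below
  the minimal one.\<close>

lemma dim_matpow_span: "dim (matpow_span A) = degree (min_poly A)"
proof -
  let ?D = "degree (min_poly A)"
  have zero: "c i = 0" if "i < ?D" "(\<Sum>i<?D. c i *\<^sub>R matpow A i) = 0" for c i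
  proof (rule ccontr)
    assume "c i \<noteq> 0"
    define q where "q = Abs_poly (\<lambda>i. if i < ?D then c i else 0)"
    have coeff: "coeff q i = (if i < ?D then c i else 0)" for i
      unfolding q_def by (subst coeff_Abs_poly [of ?D]) auto
    have deg: "degree q \<le> ?D - 1"
      by (rule degree_le) (auto simp: coeff)
    moreover have "{..?D - 1} = {..<?D}" using that(1) by auto
    ultimately have "poly_mat q A = 0"
      using that(2) by (simp add: poly_mat_ge_degree [OF deg] coeff)
    moreover have "q \<noteq> 0" using coeff [of i] \<open>c i \<noteq> 0\<close> that(1) by auto
    ultimately have "?D \<le> degree q" using min_poly(3) by blast
    with deg that(1) show False by linarith
  qed
  have inj: "inj_on (matpow A) {..<?D}"
  proof (rule inj_onI, rule ccontr)
    fix i j assume ij: "i \<in> {..<?D}" "j \<in> {..<?D}" "matpow A i = matpow A j" "i \<noteq> j"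
    let ?c = "\<lambda>k. if k = i then 1 else if k = j then - 1 else (0 :: real)"
    have "(\<Sum>k<?D. ?c k *\<^sub>R matpow A k) = (\<Sum>k\<in>{i, j}. ?c k *\<^sub>R matpow A k)"
      using ij by (intro sum.mono_neutral_right) auto
    also have "\<dots> = 0" using ij by simp
    finally show False using zero [of i ?c] ij by simp
  qed
  have "independent (matpow A ` {..<?D})"
  proof
    assume "dependent (matpow A ` {..<?D})"
    then obtain u i where "i < ?D" "u (matpow A i) \<noteq> 0" "(\<Sum>v\<in>matpow A ` {..<?D}. u v *\<^sub>R v) = 0"
      by (auto simp: dependent_finite)
    with zero [of i "\<lambda>i. u (matpow A i)"] show False
      by (simp add: sum.reindex [OF inj])
  qed
  then show ?thesis
    unfolding matpow_span_eq by (simp add: dim_eq_card_independent card_image inj)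
qed

text \<open>For a faithful point, \<open>M \<mapsto> M x\<close> identifies the algebra generated by \<open>A\<close> with the cyclic
  subspace of \<open>x\<close>. This is what makes the cut tail time independent of the base point.\<close>

definition faithful_point :: "real^'n^'n \<Rightarrow> real^'n \<Rightarrow> bool" where
  "faithful_point A x \<longleftrightarrow> (\<forall>M\<in>matpow_span A. M *v x = 0 \<longrightarrow> M = 0)"

lemma linear_matrix_vector_mult_left: "linear (\<lambda>M :: real^'n^'m. M *v x)"
  by (rule bounded_linear.linear [OF bounded_linear_matrix_vector_mult_left])

lemma invariant_subspace_image: "invariant_subspace A ((\<lambda>M. M *v x) ` matpow_span A)"
  unfolding invariant_subspace_def
proof (intro conjI ballI)
  show "subspace ((\<lambda>M. M *v x) ` matpow_span A)"
    by (intro linear_subspace_image linear_matrix_vector_mult_left subspace_span)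
  fix v assume "v \<in> (\<lambda>M. M *v x) ` matpow_span A"
  then obtain p where "v = poly_mat p A *v x" by (auto elim: matpow_spanE)
  then have "A *v v = poly_mat (pCons 0 p) A *v x"
    by (simp add: poly_mat_pCons matrix_vector_mul_assoc)
  then show "A *v v \<in> (\<lambda>M. M *v x) ` matpow_span A"
    using poly_mat_in_matpow_span by blast
qed

lemma cyclic_subspace_eq: "cyclic_subspace A x = (\<lambda>M. M *v x) ` matpow_span A"
proof
  have "x = matpow A 0 *v x" by simp
  then have "x \<in> (\<lambda>M. M *v x) ` matpow_span A"
    by (metis image_eqI rangeI span_base)
  then show "cyclic_subspace A x \<subseteq> (\<lambda>M. M *v x) ` matpow_span A"
    unfolding cyclic_subspace_def using invariant_subspace_image by (intro hull_minimal) auto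
  show "(\<lambda>M. M *v x) ` matpow_span A \<subseteq> cyclic_subspace A x"
    unfolding cyclic_subspace_def hull_def
  proof clarify
    fix M V assume M: "M \<in> matpow_span A" and V: "invariant_subspace A V" "{x} \<subseteq> V"
    have "matpow A k *v x \<in> V" for k
      using V by (induction k)
        (auto simp: invariant_subspace_def matpow_Suc matrix_vector_mul_assoc [symmetric])
    then have "(\<lambda>M. M *v x) ` range (matpow A) \<subseteq> V" by auto
    then have "(\<lambda>M. M *v x) ` matpow_span A \<subseteq> V"
      unfolding linear_span_image [OF linear_matrix_vector_mult_left, symmetric]
      using V by (intro span_minimal) (auto simp: invariant_subspace_def)
    with M show "M *v x \<in> V" by blast
  qed
qed

lemma subspace_cyclic_subspace: "subspace (cyclic_subspace A x)"
  using invariant_subspace_image [of A x]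
  by (simp add: cyclic_subspace_eq invariant_subspace_def)

text \<open>Genericity makes every vector equal to q(A) x for some q, and \<open>M\<close>, itself a
  polynomial in \<open>A\<close>, commutes with q(A).\<close>

lemma generic_point_imp_faithful:
  assumes "generic_point A x"
  shows "faithful_point A x"
  unfolding faithful_point_def
proof (intro ballI impI)
  fix M assume M: "M \<in> matpow_span A" "M *v x = 0"
  have "x = matpow A 0 *v x" by simp
  then have "x \<in> (\<lambda>M. M *v x) ` matpow_span A"
    by (metis image_eqI rangeI span_base)
  then have all: "(\<lambda>M. M *v x) ` matpow_span A = UNIV"
    using assms invariant_subspace_image unfolding generic_point_def by blast
  obtain p where p: "M = poly_mat p A" using M(1) by (rule matpow_spanE)
  have "M *v v = 0" for v
  proof -
    obtain q where "v = poly_mat q A *v x" using all by (metis (no_types) UNIV_I imageE matpow_spanE)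
    then have "M *v v = poly_mat q A *v (M *v x)"
      by (simp add: p matrix_vector_mul_assoc poly_mat_mult_commute)
    then show ?thesis by (simp add: M)
  qed
  then show "M = 0" by (simp add: matrix_eq)
qed

text \<open>The images at \<open>x\<close> of the powers below the degree span a space whose
  dimension is the number of these powers. Hence they are distinct and independent, and evaluation
  at \<open>x\<close> is injective on the span of the powers.\<close>

lemma dim_cyclic_subspace_imp_faithful:
  assumes "dim (cyclic_subspace A x) = degree (min_poly A)"
  shows "faithful_point A x"
proof -
  let ?f = "\<lambda>M. M *v x" and ?B = "matpow A ` {..<degree (min_poly A)}"
  have L: "cyclic_subspace A x = span (?f ` ?B)"
    unfolding cyclic_subspace_eq matpow_span_eq by (simp add: linear_span_image [OF linear_matrix_vector_mult_left])
  have fin: "finite ?B" by simp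
  have c1: "card ?B \<le> degree (min_poly A)"
    using card_image_le [of "{..<degree (min_poly A)}" "matpow A"] by simp
  have c2: "card (?f ` ?B) \<le> card ?B" by (rule card_image_le [OF fin])
  have d: "dim (span (?f ` ?B)) = degree (min_poly A)" using assms L by simp
  have c3: "dim (span (?f ` ?B)) \<le> card (?f ` ?B)" by (simp add: dim_le_card')
  have "independent (?f ` ?B)"
    by (rule card_le_dim_spanning [of _ "span (?f ` ?B)"]) (use c1 c2 d in \<open>auto intro: span_base\<close>)
  moreover have "inj_on ?f ?B"
    by (rule eq_card_imp_inj_on [OF fin]) (use c1 c2 c3 d in linarith)
  ultimately have "inj_on ?f (span ?B)"
    by (rule linear_inj_on_span_independent_image [OF linear_matrix_vector_mult_left])
  then show ?thesis
    unfolding faithful_point_def matpow_span_eq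
    using linear_inj_on_iff_eq_0 [OF linear_matrix_vector_mult_left subspace_span] by blast
qed

lemma faithful_imp_dim_cyclic_subspace:
  assumes "faithful_point A x"
  shows "dim (cyclic_subspace A x) = degree (min_poly A)"
proof -
  have "inj_on (\<lambda>M. M *v x) (matpow_span A)"
    using assms linear_inj_on_iff_eq_0 [OF linear_matrix_vector_mult_left subspace_span]
    unfolding faithful_point_def by blast
  then have "dim ((\<lambda>M. M *v x) ` matpow_span A) = dim (matpow_span A)"
    by (intro dim_image_eq linear_matrix_vector_mult_left) (simp only: span_span)
  then show ?thesis by (simp only: cyclic_subspace_eq dim_matpow_span)
qed

lemma base_point_imp_faithful: "base_point A x \<Longrightarrow> faithful_point A x"
  unfolding base_point_def
  using generic_point_imp_faithful dim_cyclic_subspace_imp_faithful by (auto split: if_splits)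

text \<open>Proper subspaces are Lebesgue null sets, and finitely many null sets do not cover the
  space.\<close>

lemma ex_outside_finite_proper_subspaces:
  fixes \<V> :: "('a::euclidean_space) set set"
  assumes "finite \<V>" "\<And>V. V \<in> \<V> \<Longrightarrow> subspace V \<and> V \<noteq> UNIV"
  obtains x where "x \<notin> \<Union>\<V>"
proof -
  have "negligible V" if "V \<in> \<V>" for V
  proof (rule negligible_lowdim)
    have "span V \<noteq> UNIV" using assms(2) [OF that] by (metis span_eq_iff)
    then show "dim V < DIM('a)"
      using dim_eq_full [of V] dim_subset_UNIV [of V] by linarith
  qed
  then have "negligible (\<Union>\<V>)" using assms(1) by blast
  then show ?thesis using that non_negligible_UNIV by (metis UNIV_eq_I)
qed

text \<open>A point is faithful as soon as it is annihilated by none of the matrices \<open>(\<mu>/p)(A)\<close>,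
  where \<open>p\<close> runs over the prime divisors of the minimal polynomial \<open>\<mu>\<close>.\<close>

lemma ex_faithful_point:
  fixes A :: "real^'n^'n"
  obtains x where "faithful_point A x"
proof -
  let ?\<mu> = "min_poly A"
  let ?Pr = "{p. prime p \<and> p dvd ?\<mu>}"
  let ?K = "\<lambda>p. {v. poly_mat (?\<mu> div p) A *v v = 0}"
  have proper: "subspace (?K p) \<and> ?K p \<noteq> UNIV" if "p \<in> ?Pr" for p
  proof
    show "subspace (?K p)"
      by (rule linear_subspace_kernel) simp
    have eq: "p * (?\<mu> div p) = ?\<mu>" using that by (simp add: dvd_mult_div_cancel)
    then have "p * (?\<mu> div p) \<noteq> 0" using min_poly_nonzero by metis
    then have nz: "?\<mu> div p \<noteq> 0" "p \<noteq> 0" by auto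
    have "degree p > 0"
      using that nz is_unit_iff_degree [of p] not_prime_unit by blast
    moreover have "degree ?\<mu> = degree p + degree (?\<mu> div p)"
      using degree_mult_eq [OF nz(2,1)] by (simp only: eq)
    ultimately have "degree (?\<mu> div p) < degree ?\<mu>" by simp
    then have "poly_mat (?\<mu> div p) A \<noteq> 0"
      using min_poly(3) [of "?\<mu> div p" A] nz(1) by force
    then show "?K p \<noteq> UNIV"
      unfolding matrix_eq by auto
  qed
  \<comment> \<open>\<open>prime\<close> selects normalised elements, so a factor counts once and
    not with all its scalar multiples.\<close>
  have "finite (?K ` ?Pr)"
    by (intro finite_imageI finite_prime_divisors min_poly_nonzero)
  then obtain x where x: "x \<notin> \<Union>(?K ` ?Pr)"
    by (rule ex_outside_finite_proper_subspaces) (use proper in blast)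
  let ?P = "\<lambda>q. q \<noteq> 0 \<and> poly_mat q A *v x = 0"
  have "?P ?\<mu>" by (simp add: min_poly(2) min_poly_nonzero)
  then have "?P (arg_min degree ?P) \<and> (\<forall>q. ?P q \<longrightarrow> degree (arg_min degree ?P) \<le> degree q)"
    by (rule arg_min_nat_lemma)
  then obtain q where q: "?P q" and min: "\<And>r. ?P r \<Longrightarrow> degree q \<le> degree r"
    by blast
  have dvd: "q dvd r" if r: "poly_mat r A *v x = 0" for r
  proof -
    have "r mod q = r - q * (r div q)" by (simp add: minus_mult_div_eq_mod)
    then have "poly_mat (r mod q) A *v x = poly_mat r A *v x - poly_mat (r div q) A *v (poly_mat q A *v x)"
      by (simp add: poly_mat_diff poly_mat_mult matrix_vector_mult_diff_rdistrib
          matrix_vector_mul_assoc poly_mat_mult_commute)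
    then have "poly_mat (r mod q) A *v x = 0" using r q by simp
    moreover have "r mod q = 0 \<or> degree (r mod q) < degree q"
      using q by (intro degree_mod_less) blast
    ultimately have "r mod q = 0"
      using min [of "r mod q"] by (meson not_less)
    then show ?thesis by (simp add: dvd_eq_mod_eq_0)
  qed
  have "q dvd ?\<mu>" by (rule dvd) (simp add: min_poly(2))
  then obtain h where h: "?\<mu> = q * h" by (rule dvdE)
  \<comment> \<open>\<open>q\<close> generates the ideal of polynomials annihilating
    \<open>x\<close>. A prime p dividing \<open>h\<close> would make \<open>q\<close> divide
    \<mu>/p, so that (\<mu>/p)(A) x = 0 against the choice of \<open>x\<close>.\<close>
  have "is_unit h"
  proof (rule ccontr)
    assume "\<not> is_unit h"
    moreover have "h \<noteq> 0" using h min_poly_nonzero [of A] by auto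
    ultimately have "\<exists>p. p dvd h \<and> prime p" by (intro prime_divisor_exists)
    then obtain p where p: "p dvd h" "prime p" by blast
    from p(1) obtain k where k: "h = p * k" by (rule dvdE)
    then have "?\<mu> = p * (k * q)"
      unfolding h k by (simp only: mult_ac)
    moreover have "p \<noteq> 0" using p(2) not_prime_0 by metis
    ultimately have "?\<mu> div p = k * q"
      using nonzero_mult_div_cancel_left [of p "k * q"] by simp
    then have "poly_mat (?\<mu> div p) A *v x = 0"
      using q by (simp add: poly_mat_mult matrix_vector_mul_assoc [symmetric])
    moreover have "p \<in> ?Pr"
      using p dvd_trans [OF p(1) dvdI [OF h [unfolded mult.commute [of q]]]] by simp
    ultimately show False using x by blast
  qed
  then have \<mu>q: "?\<mu> dvd q" unfolding h by (simp only: mult_unit_dvd_iff dvd_refl)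
  show ?thesis
  proof (rule that, unfold faithful_point_def, intro ballI impI)
    fix M assume "M \<in> matpow_span A" "M *v x = 0"
    moreover from this(1) obtain r where r: "M = poly_mat r A" by (rule matpow_spanE)
    ultimately have "?\<mu> dvd r" using dvd \<mu>q dvd_trans by blast
    then show "M = 0" using r by (auto simp: poly_mat_mult min_poly(2) elim!: dvdE)
  qed
qed

text \<open>Gives the \<open>LEAST\<close> in \<open>T_cut\<close> something to range over: where no
  point is generic, a faithful point has a cyclic subspace of the required dimension.\<close>

lemma ex_base_point:
  obtains x where "base_point A x"
proof (cases "\<exists>y. generic_point A y")
  case True
  then show ?thesis using that unfolding base_point_def by auto
next
  case False
  obtain x where "faithful_point A x" by (rule ex_faithful_point)
  then show ?thesis
    using False that [of x] faithful_imp_dim_cyclic_subspace [of A x] unfolding base_point_def by simp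
qed

section \<open>Cut tail points\<close>

lemma sym_convex_hull_uminus:
  assumes "g \<in> sym_convex_hull M"
  shows "- g \<in> sym_convex_hull M"
proof -
  have "uminus ` (convex hull (M \<union> uminus ` M)) = convex hull (M \<union> uminus ` M)"
    by (simp add: convex_hull_linear_image [OF linear_uminus] image_Un image_image Un_commute)
  with assms show ?thesis
    unfolding sym_convex_hull_def by (metis imageI)
qed

lemma sym_convex_hull_bound:
  assumes "g \<in> sym_convex_hull M" "\<And>x. x \<in> M \<Longrightarrow> \<bar>c \<bullet> x\<bar> \<le> b"
  shows "\<bar>c \<bullet> g\<bar> \<le> b"
proof -
  have "convex ({g. c \<bullet> g \<le> b} \<inter> {g. c \<bullet> g \<ge> - b})"
    by (intro convex_Int convex_halfspace_le convex_halfspace_ge)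
  then have "sym_convex_hull M \<subseteq> {g. c \<bullet> g \<le> b} \<inter> {g. c \<bullet> g \<ge> - b}"
    unfolding sym_convex_hull_def using assms(2)
    by (intro hull_minimal) (force simp: abs_le_iff)+
  with assms(1) show ?thesis by (auto simp: abs_le_iff)
qed

lemma sym_convex_hull_subset_subspace:
  assumes "subspace L" "M \<subseteq> L"
  shows "sym_convex_hull M \<subseteq> L"
  unfolding sym_convex_hull_def using assms
  by (intro hull_minimal subspace_imp_convex) (auto intro: subspace_neg)

text \<open>Separation inside \<open>L\<close>. If the hull spans \<open>L\<close>, its interior in
  \<open>L\<close> is its relative interior, because symmetry puts 0 into it, and a separating
  hyperplane exists. Otherwise a vector of \<open>L\<close> orthogonal to the hull will do. Symmetry
  also turns the one-sided bound into one for absolute values.\<close>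

lemma not_in_interior_of_sym_convex_hull:
  fixes M L :: "(real^'n) set"
  assumes L: "subspace L" and M: "M \<subseteq> L" "M \<noteq> {}" and y: "y \<in> L"
    and nin: "y \<notin> top_of_set L interior_of sym_convex_hull M"
  obtains c where "c \<in> L" "c \<noteq> 0" "\<And>x. x \<in> M \<Longrightarrow> \<bar>c \<bullet> x\<bar> \<le> c \<bullet> y"
proof -
  let ?G = "sym_convex_hull M"
  have GL: "?G \<subseteq> L" using sym_convex_hull_subset_subspace L M(1) .
  have conv: "convex ?G" by (simp add: sym_convex_hull_def)
  have MG: "M \<subseteq> ?G" unfolding sym_convex_hull_def by (meson Un_upper1 hull_subset order_trans)
  have "\<exists>c. c \<in> L \<and> c \<noteq> 0 \<and> (\<forall>x\<in>?G. c \<bullet> x \<le> c \<bullet> y)"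
  proof (cases "span ?G = L")
    case True
    obtain g where g: "g \<in> ?G" using MG M(2) by blast
    have "(1/2) *\<^sub>R g + (1/2) *\<^sub>R (- g) \<in> ?G"
      by (rule convexD [OF conv g sym_convex_hull_uminus [OF g]]) auto
    then have "0 \<in> affine hull ?G" by (simp add: hull_inc)
    then have aff: "affine hull ?G = L" using affine_hull_span_0 True by blast
    have "rel_interior ?G = top_of_set L interior_of ?G"
      unfolding rel_interior_def interior_of_def aff by blast
    then have "y \<notin> rel_interior ?G" using nin by simp
    moreover have "rel_interior ?G \<noteq> {}" using g rel_interior_eq_empty [OF conv] by blast
    \<comment> \<open>The clause on \<open>y + a\<close> is what places the normal direction
      \<open>a\<close> in \<open>L\<close>.\<close>
    ultimately obtain a b where ab: "y + a \<in> affine hull (insert y (rel_interior ?G))" "a \<noteq> 0"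
      "a \<bullet> y \<le> b" "\<And>x. x \<in> rel_interior ?G \<Longrightarrow> b \<le> a \<bullet> x"
      using separating_hyperplane_set_point_inaff [OF convex_rel_interior [OF conv]] by metis
    have "affine hull (insert y (rel_interior ?G)) \<subseteq> L"
      using y GL rel_interior_subset [of ?G] subspace_imp_affine [OF L]
      by (intro hull_minimal) auto
    then have "a \<in> L"
      using ab(1) y subspace_diff [OF L, of "y + a" y] by auto
    moreover have "b \<le> a \<bullet> x" if "x \<in> ?G" for x
    proof -
      have "closure (rel_interior ?G) \<subseteq> {x. a \<bullet> x \<ge> b}"
        using ab(4) closed_halfspace_ge by (intro closure_minimal) auto
      then show ?thesis
        using that closure_subset [of ?G] convex_closure_rel_interior [OF conv] by auto
    qed
    ultimately show ?thesis
      using ab(2,3) subspace_neg [OF L] by (intro exI [of _ "- a"]) force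
  next
    case False
    then have "span ?G \<subset> span L"
      using span_minimal [OF GL L] L by (simp add: span_eq_iff [THEN iffD2] psubset_eq)
    then obtain a where a: "a \<noteq> 0" "a \<in> span L" "\<And>x. x \<in> span ?G \<Longrightarrow> orthogonal a x"
      by (rule orthogonal_to_subspace_exists_gen) blast
    define c where "c = (if a \<bullet> y \<ge> 0 then a else - a)"
    have "a \<in> L" using a(2) L by (simp add: span_eq_iff [THEN iffD2])
    then have "c \<in> L" "c \<noteq> 0" "c \<bullet> y \<ge> 0"
      using a(1) subspace_neg [OF L] by (auto simp: c_def)
    moreover have "c \<bullet> x = 0" if "x \<in> ?G" for x
      using a(3) [OF span_base [OF that]] by (simp add: c_def orthogonal_def)
    ultimately show ?thesis by (intro exI [of _ c]) simp
  qed
  then obtain c where c: "c \<in> L" "c \<noteq> 0" "\<And>x. x \<in> ?G \<Longrightarrow> c \<bullet> x \<le> c \<bullet> y" by blast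
  show ?thesis
  proof (rule that [OF c(1,2)])
    fix x assume "x \<in> M"
    then have "x \<in> ?G" using MG by blast
    then show "\<bar>c \<bullet> x\<bar> \<le> c \<bullet> y"
      using c(3) [of x] c(3) [OF sym_convex_hull_uminus [of x M]] by (simp add: abs_le_iff)
  qed
qed

text \<open>As \<open>c\<close> does not vanish on \<open>L\<close>, a small move of
  \<open>y\<close> inside \<open>L\<close> increases \<open>c\<close> without leaving the hull, so
  the value at \<open>y\<close> cannot dominate \<open>c\<close> on the generators.\<close>

lemma in_interior_of_sym_convex_hull_imp:
  fixes M L :: "(real^'n) set"
  assumes L: "subspace L" and y: "y \<in> top_of_set L interior_of sym_convex_hull M"
    and z: "z \<in> L" "c \<bullet> z \<noteq> 0"
  shows "\<exists>x\<in>M. \<bar>c \<bullet> x\<bar> > c \<bullet> y"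
proof (rule ccontr)
  assume "\<not> ?thesis"
  then have bound: "c \<bullet> g \<le> c \<bullet> y" if "g \<in> sym_convex_hull M" for g
    using sym_convex_hull_bound [OF that, of c "c \<bullet> y"] by force
  obtain T where T: "openin (top_of_set L) T" "y \<in> T" "T \<subseteq> sym_convex_hull M"
    using y by (auto simp: interior_of_def)
  then obtain e where e: "e > 0" "ball y e \<inter> L \<subseteq> T"
    using openin_contains_ball [of L T] by blast
  have yL: "y \<in> L" using T(1,2) openin_imp_subset by blast
  define w where "w = (c \<bullet> z) *\<^sub>R z"
  have w: "w \<in> L" "c \<bullet> w > 0" "w \<noteq> 0"
    using z subspace_scale [OF L] by (auto simp: w_def zero_less_mult_iff linorder_neq_iff)
  define d where "d = e / (2 * norm w)"
  have d: "d > 0" using e(1) w(3) by (simp add: d_def)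
  have "norm (d *\<^sub>R w) < e" using e(1) w(3) by (simp add: d_def)
  then have "y + d *\<^sub>R w \<in> ball y e \<inter> L"
    using yL w(1) L by (simp add: dist_norm subspace_add subspace_scale)
  then have "c \<bullet> (y + d *\<^sub>R w) \<le> c \<bullet> y" using bound e(2) T(3) by blast
  with d w(2) show False by (simp add: inner_add_right mult_le_0_iff)
qed

context
  fixes A :: "real^'n^'n"
begin

lemma matexp_in_matpow_span: "matexp (t *\<^sub>R A) \<in> matpow_span A"
proof -
  have lim: "(\<lambda>n. \<Sum>k<n. matpow (t *\<^sub>R A) k /\<^sub>R fact k) \<longlonglongrightarrow> matexp (t *\<^sub>R A)"
    unfolding matexp_def using summable_sums [OF matexp_summable] by (simp add: sums_def)
  have mem: "(\<Sum>k<n. matpow (t *\<^sub>R A) k /\<^sub>R fact k) \<in> matpow_span A" for n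
    unfolding matpow_scaleR by (intro span_sum span_scale span_base rangeI)
  show ?thesis
    by (rule closed_sequentially [OF closed_subspace [OF subspace_span] mem lim])
qed

lemma matexp_mult_in_cyclic_subspace: "matexp (t *\<^sub>R A) *v x \<in> cyclic_subspace A x"
  unfolding cyclic_subspace_eq using matexp_in_matpow_span by blast

text \<open>The vectors whose forward orbit is orthogonal to \<open>c\<close> form an invariant
  subspace: differentiating the vanishing function from the right gives invariance under
  \<open>A\<close>.\<close>

lemma orthogonal_to_orbit_imp:
  assumes orth: "\<And>s. s \<ge> 0 \<Longrightarrow> c \<bullet> (matexp (s *\<^sub>R A) *v x) = 0" and z: "z \<in> cyclic_subspace A x"
  shows "c \<bullet> z = 0"
proof -
  define V where "V = {z. \<forall>s\<ge>0. c \<bullet> (matexp (s *\<^sub>R A) *v z) = 0}"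
  have "invariant_subspace A V"
    unfolding invariant_subspace_def
  proof (intro conjI ballI)
    show "subspace V"
      by (auto simp: V_def subspace_def matrix_vector_right_distrib inner_add_right
          matrix_vector_mult_scaleR)
    fix v assume v: "v \<in> V"
    have "c \<bullet> (matexp (s *\<^sub>R A) *v (A *v v)) = 0" if s: "s \<ge> 0" for s
    proof -
      have "((\<lambda>r. c \<bullet> (matexp (r *\<^sub>R A) *v v)) has_vector_derivative
          c \<bullet> (A *v (matexp (s *\<^sub>R A) *v v))) (at s within {s..s + 1})"
        by (intro bounded_linear.has_vector_derivative [OF bounded_linear_inner_right]
            matexp_mult_has_vector_derivative)
      moreover have "((\<lambda>r. c \<bullet> (matexp (r *\<^sub>R A) *v v)) has_vector_derivative 0) (at s within {s..s + 1})"
        by (rule has_vector_derivative_transform [of _ _ _ "\<lambda>_. 0"])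
          (use v s in \<open>auto simp: V_def\<close>)
      moreover have "at s within {s..s + 1} \<noteq> bot"
        by (simp add: at_within_Icc_at_right)
      ultimately have "c \<bullet> (A *v (matexp (s *\<^sub>R A) *v v)) = 0"
        using vector_derivative_unique_within by blast
      then show ?thesis
        by (simp add: matrix_vector_mul_assoc matexp_commute)
    qed
    then show "A *v v \<in> V" by (simp add: V_def)
  qed
  moreover have "x \<in> V" using orth by (simp add: V_def)
  ultimately have "cyclic_subspace A x \<subseteq> V"
    unfolding cyclic_subspace_def by (intro hull_minimal) auto
  with z have "z \<in> V" by blast
  then have "c \<bullet> (matexp (0 *\<^sub>R A) *v z) = 0" unfolding V_def by blast
  then show ?thesis by simp
qed

lemma orbit_not_in_interior:
  assumes "T \<ge> 0"
    and "matexp (t *\<^sub>R A) *v x \<notin> top_of_set (cyclic_subspace A x) interior_of orbit_hull A x 0 T"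
  obtains c where "c \<in> cyclic_subspace A x" "c \<noteq> 0"
    "\<And>s. 0 \<le> s \<Longrightarrow> s \<le> T \<Longrightarrow> \<bar>c \<bullet> (matexp (s *\<^sub>R A) *v x)\<bar> \<le> c \<bullet> (matexp (t *\<^sub>R A) *v x)"
proof -
  have "(\<lambda>s. matexp (s *\<^sub>R A) *v x) ` {0..T} \<subseteq> cyclic_subspace A x"
    using matexp_mult_in_cyclic_subspace by blast
  moreover have "(\<lambda>s. matexp (s *\<^sub>R A) *v x) ` {0..T} \<noteq> {}"
    using assms(1) by simp
  ultimately obtain c where c: "c \<in> cyclic_subspace A x" "c \<noteq> 0"
    "\<And>v. v \<in> (\<lambda>s. matexp (s *\<^sub>R A) *v x) ` {0..T} \<Longrightarrow> \<bar>c \<bullet> v\<bar> \<le> c \<bullet> (matexp (t *\<^sub>R A) *v x)"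
    by (rule not_in_interior_of_sym_convex_hull [OF subspace_cyclic_subspace _ _ matexp_mult_in_cyclic_subspace
        assms(2) [unfolded orbit_hull_def]]) blast
  show ?thesis by (rule that [OF c(1,2)]) (rule c(3), auto)
qed

lemma orbit_in_interior_imp:
  assumes "matexp (t *\<^sub>R A) *v x \<in> top_of_set (cyclic_subspace A x) interior_of orbit_hull A x 0 T"
    and "z \<in> cyclic_subspace A x" "c \<bullet> z \<noteq> 0"
  obtains s where "0 \<le> s" "s \<le> T" "\<bar>c \<bullet> (matexp (s *\<^sub>R A) *v x)\<bar> > c \<bullet> (matexp (t *\<^sub>R A) *v x)"
  using in_interior_of_sym_convex_hull_imp [OF subspace_cyclic_subspace assms(1) [unfolded orbit_hull_def] assms(2,3)]
  by auto

lemma cut_tail_point_mono: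
  assumes "cut_tail_point A x T" "T \<le> T'"
  shows "cut_tail_point A x T'"
proof -
  have "orbit_hull A x 0 T \<subseteq> orbit_hull A x 0 T'"
    unfolding orbit_hull_def sym_convex_hull_def using assms(2) by (intro hull_mono) auto
  from interior_of_mono [OF this] assms show ?thesis
    unfolding cut_tail_point_def by force
qed

text \<open>If no integer n qualifies, there are unit vectors c_n in the cyclic subspace whose
  products with the orbit on [0, n] are bounded by the norm of a point at a time beyond n. These
  norms tend to 0, so a limit of the c_n is a unit vector of the cyclic subspace orthogonal to the
  whole orbit, which is impossible.\<close>

lemma ex_cut_tail_point:
  assumes "hurwitz A"
  shows "\<exists>T. cut_tail_point A x T"
proof (rule ccontr)
  let ?y = "\<lambda>t. matexp (t *\<^sub>R A) *v x" and ?L = "cyclic_subspace A x"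
  assume neg: "\<not> ?thesis"
  have "\<exists>t c. t > real n \<and> c \<in> ?L \<and> norm c = 1 \<and> (\<forall>s. 0 \<le> s \<and> s \<le> real n \<longrightarrow> \<bar>c \<bullet> ?y s\<bar> \<le> norm (?y t))" for n
  proof -
    have "\<not> cut_tail_point A x (real n)" using neg by blast
    then obtain t where t: "t > real n" "?y t \<notin> top_of_set ?L interior_of orbit_hull A x 0 (real n)"
      unfolding cut_tail_point_def by auto
    obtain c where c: "c \<in> ?L" "c \<noteq> 0" "\<And>s. 0 \<le> s \<Longrightarrow> s \<le> real n \<Longrightarrow> \<bar>c \<bullet> ?y s\<bar> \<le> c \<bullet> ?y t"
      using orbit_not_in_interior [OF of_nat_0_le_iff t(2)] by blast
    let ?c = "c /\<^sub>R norm c"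
    have "\<bar>?c \<bullet> ?y s\<bar> \<le> norm (?y t)" if "0 \<le> s" "s \<le> real n" for s
    proof -
      have "\<bar>c \<bullet> ?y s\<bar> \<le> norm c * norm (?y t)"
        using c(3) [OF that] norm_cauchy_schwarz [of c "?y t"] by linarith
      then show ?thesis using c(2) by (simp add: abs_mult field_simps)
    qed
    moreover have "?c \<in> ?L" using c(1) subspace_cyclic_subspace subspace_scale by blast
    ultimately show ?thesis using t(1) c(2) by (intro exI [of _ t] exI [of _ ?c]) auto
  qed
  then obtain t c where tc: "\<And>n. t n > real n" "\<And>n. c n \<in> ?L" "\<And>n. norm (c n) = 1"
    "\<And>n s. 0 \<le> s \<Longrightarrow> s \<le> real n \<Longrightarrow> \<bar>c n \<bullet> ?y s\<bar> \<le> norm (?y (t n))"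
    by metis
  have "compact (?L \<inter> sphere 0 1)"
    by (intro closed_Int_compact closed_subspace subspace_cyclic_subspace compact_sphere)
  moreover have "\<forall>n. c n \<in> ?L \<inter> sphere 0 1" using tc by simp
  ultimately obtain l r where l: "l \<in> ?L \<inter> sphere 0 1" "strict_mono r" "(c \<circ> r) \<longlonglongrightarrow> l"
    unfolding compact_def by blast
  have t_lim: "filterlim t at_top sequentially"
    using tc(1) by (intro filterlim_at_top_mono [OF filterlim_real_sequentially]) (simp add: less_imp_le)
  have "(\<lambda>n. norm (?y (t (r n)))) \<longlonglongrightarrow> 0"
    using tendsto_norm_zero [OF hurwitz_matexp_mult_tendsto_0 [OF assms, of x]]
    by (rule filterlim_compose)
      (rule filterlim_compose [OF t_lim filterlim_subseq [OF l(2)]])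
  moreover have "l \<bullet> ?y s = 0" if "s \<ge> 0" for s
  proof -
    have "(\<lambda>n. norm ((c \<circ> r) n \<bullet> ?y s)) \<longlonglongrightarrow> 0"
    proof (rule tendsto_sandwich [OF _ _ tendsto_const])
      have "\<forall>\<^sub>F n in sequentially. s \<le> real n"
        using eventually_ge_at_top [of "nat \<lceil>s\<rceil>"] by eventually_elim linarith
      then show "\<forall>\<^sub>F n in sequentially. norm ((c \<circ> r) n \<bullet> ?y s) \<le> norm (?y (t (r n)))"
      proof eventually_elim
        case (elim n)
        then have "s \<le> real (r n)" using seq_suble [OF l(2), of n] by linarith
        then show ?case using tc(4) that by simp
      qed
    qed (use \<open>(\<lambda>n. norm (?y (t (r n)))) \<longlonglongrightarrow> 0\<close> in auto)
    then have "(\<lambda>n. (c \<circ> r) n \<bullet> ?y s) \<longlonglongrightarrow> 0" by (rule tendsto_norm_zero_cancel)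
    moreover have "(\<lambda>n. (c \<circ> r) n \<bullet> ?y s) \<longlonglongrightarrow> l \<bullet> ?y s"
      by (intro tendsto_inner l(3) tendsto_const)
    ultimately show ?thesis using LIMSEQ_unique by blast
  qed
  ultimately have "l \<bullet> l = 0"
    using l(1) orthogonal_to_orbit_imp by blast
  then show False using l(1) by simp
qed

text \<open>If the infimum \<open>T0\<close> were not a cut tail point, a functional \<open>f\<close> on the orbit would attain its global
  maximum at some \<open>s > T0\<close>, so no time in \<open>(T0, s)\<close> could be a cut tail point.\<close>

lemma ex_least_cut_tail_point:
  assumes "hurwitz A"
  obtains T where "cut_tail_point A x T" "\<And>T'. cut_tail_point A x T' \<Longrightarrow> T \<le> T'"
proof -
  let ?y = "\<lambda>t. matexp (t *\<^sub>R A) *v x" and ?L = "cyclic_subspace A x"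
  define S where "S = {T. cut_tail_point A x T}"
  have ne: "S \<noteq> {}" using ex_cut_tail_point [OF assms, of x] by (simp add: S_def)
  have bd: "bdd_below S" by (rule bdd_belowI [of _ 0]) (simp add: S_def cut_tail_point_def)
  define T0 where "T0 = Inf S"
  have T0: "T0 \<ge> 0"
    unfolding T0_def using ne by (rule cInf_greatest) (simp add: S_def cut_tail_point_def)
  have above: "cut_tail_point A x T" if "T > T0" for T
    using that cInf_lessD [OF ne] cut_tail_point_mono by (force simp: S_def T0_def)
  have "?y t \<in> top_of_set ?L interior_of orbit_hull A x 0 T0" if t: "t > T0" for t
  proof (rule ccontr)
    assume "\<not> ?thesis"
    then obtain c where c: "c \<in> ?L" "c \<noteq> 0" "\<And>s. 0 \<le> s \<Longrightarrow> s \<le> T0 \<Longrightarrow> \<bar>c \<bullet> ?y s\<bar> \<le> c \<bullet> ?y t"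
      using orbit_not_in_interior [OF T0] by blast
    define f where "f s = c \<bullet> ?y s" for s
    have cont: "continuous_on S f" for S
      unfolding f_def
      by (intro continuous_on_inner continuous_on_const)
        (use matexp_mult_has_vector_derivative has_vector_derivative_continuous in
          \<open>fastforce simp: continuous_on_eq_continuous_within\<close>)
    obtain s0 where s0: "s0 \<ge> 0" "f s0 \<noteq> 0"
      using orthogonal_to_orbit_imp [of c x c] c(1,2) unfolding f_def by auto
    have "(f \<longlongrightarrow> c \<bullet> 0) at_top"
      unfolding f_def by (intro tendsto_inner tendsto_const hurwitz_matexp_mult_tendsto_0 assms)
    then have "\<forall>\<^sub>F s in at_top. \<bar>f s\<bar> < \<bar>f s0\<bar>"
      using s0 tendstoD [of f 0 at_top "\<bar>f s0\<bar>"] by simp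
    then obtain B where B: "\<And>s. s \<ge> B \<Longrightarrow> \<bar>f s\<bar> < \<bar>f s0\<bar>"
      by (auto simp: eventually_at_top_linorder)
    have "\<exists>s\<in>{0..max B s0}. \<forall>r\<in>{0..max B s0}. \<bar>f r\<bar> \<le> \<bar>f s\<bar>"
      by (rule continuous_attains_sup) (use s0 in \<open>auto intro!: continuous_intros cont\<close>)
    then obtain s1 where s1: "s1 \<ge> 0" "\<And>r. r \<in> {0..max B s0} \<Longrightarrow> \<bar>f r\<bar> \<le> \<bar>f s1\<bar>"
      by auto
    have s1_max: "\<bar>f r\<bar> \<le> \<bar>f s1\<bar>" if "r \<ge> 0" for r
      using s1(2) [of r] s1(2) [of s0] B [of r] s0 that by fastforce
    \<comment> \<open>If the maximiser lies in [0, T0], the bound by the value at \<open>t\<close>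
      moves the maximum to \<open>t\<close>, which exceeds \<open>T0\<close>.\<close>
    obtain s where s: "s > T0" "\<And>r. r \<ge> 0 \<Longrightarrow> \<bar>f r\<bar> \<le> \<bar>f s\<bar>"
    proof (cases "s1 > T0")
      case True
      with s1_max that show thesis by blast
    next
      case False
      then have "\<bar>f s1\<bar> \<le> \<bar>f t\<bar>" using c(3) [of s1] s1(1) by (simp add: f_def)
      with s1_max t that show thesis by (meson order_trans)
    qed
    have "f s \<noteq> 0" using s(2) [of s0] s0 by auto
    \<comment> \<open>The sign makes the value at \<open>s\<close> positive, because
      \<open>orbit_in_interior_imp\<close> compares an absolute value with a signed one.\<close>
    define c' where "c' = sgn (f s) *\<^sub>R c"
    have c'y: "c' \<bullet> ?y s = \<bar>f s\<bar>" "\<bar>c' \<bullet> ?y r\<bar> = \<bar>f r\<bar>" for r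
      using \<open>f s \<noteq> 0\<close>
      by (simp_all add: c'_def f_def [symmetric] abs_mult abs_sgn_eq mult.commute [of "sgn _"] flip: abs_sgn)
    have "cut_tail_point A x ((T0 + s) / 2)" using above s(1) by simp
    then have "?y s \<in> top_of_set ?L interior_of orbit_hull A x 0 ((T0 + s) / 2)"
      using s(1) by (simp add: cut_tail_point_def)
    then obtain r where "0 \<le> r" "\<bar>c' \<bullet> ?y r\<bar> > c' \<bullet> ?y s"
      by (rule orbit_in_interior_imp [where z = "?y s" and c = c'])
        (use matexp_mult_in_cyclic_subspace c'y \<open>f s \<noteq> 0\<close> in auto)
    then show False using c'y s(2) [of r] by simp
  qed
  then have "cut_tail_point A x T0" using T0 by (simp add: cut_tail_point_def)
  then show ?thesis
    using that bd cInf_lower by (metis S_def T0_def mem_Collect_eq)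
qed

text \<open>Evaluation at a faithful \<open>x\<close> has a linear left inverse, so a linear map
  \<phi> carries the orbit of \<open>x\<close> to that of \<open>y\<close>. A functional that
  violates the property at \<open>y\<close> pulls back along \<phi> to one that violates it at
  \<open>x\<close>.\<close>

lemma cut_tail_point_independent:
  assumes cut: "cut_tail_point A x T" and x: "faithful_point A x"
  shows "cut_tail_point A y T"
  unfolding cut_tail_point_def
proof (intro conjI allI impI)
  show "0 \<le> T" using cut by (simp add: cut_tail_point_def)
  fix t assume t: "T < t"
  have "inj_on (\<lambda>M. M *v x) (matpow_span A)"
    using x linear_inj_on_iff_eq_0 [OF linear_matrix_vector_mult_left subspace_span]
    unfolding faithful_point_def by blast
  then obtain g :: "real^'n \<Rightarrow> real^'n^'n" where g: "linear g" "\<And>M. M \<in> matpow_span A \<Longrightarrow> g (M *v x) = M"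
    using linear_exists_left_inverse_on [OF linear_matrix_vector_mult_left subspace_span] by blast
  define \<phi> where "\<phi> v = g v *v y" for v
  have lin: "linear \<phi>"
    using linear_compose [OF g(1) linear_matrix_vector_mult_left [of y]] by (simp add: \<phi>_def [abs_def] o_def)
  have \<phi>: "\<phi> (M *v x) = M *v y" if "M \<in> matpow_span A" for M
    using g(2) [OF that] by (simp add: \<phi>_def)
  show "matexp (t *\<^sub>R A) *v y \<in> top_of_set (cyclic_subspace A y) interior_of orbit_hull A y 0 T"
  proof (rule ccontr)
    assume "\<not> ?thesis"
    then obtain c where c: "c \<in> cyclic_subspace A y" "c \<noteq> 0"
      "\<And>s. 0 \<le> s \<Longrightarrow> s \<le> T \<Longrightarrow> \<bar>c \<bullet> (matexp (s *\<^sub>R A) *v y)\<bar> \<le> c \<bullet> (matexp (t *\<^sub>R A) *v y)"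
      using orbit_not_in_interior [OF \<open>0 \<le> T\<close>] by blast
    then obtain M where M: "M \<in> matpow_span A" "c = M *v y" by (auto simp: cyclic_subspace_eq)
    have adj: "adjoint \<phi> c \<bullet> v = c \<bullet> \<phi> v" for v
      using adjoint_works [OF lin, of v c] by (simp add: inner_commute)
    have Mx: "M *v x \<in> cyclic_subspace A x"
      using M(1) by (simp add: cyclic_subspace_eq)
    \<comment> \<open>The pulled-back functional must not vanish on the cyclic subspace of
      \<open>x\<close>; the witness is \<open>M *v x\<close>, where
      \<open>c = M *v y\<close>.\<close>
    have "adjoint \<phi> c \<bullet> (M *v x) = c \<bullet> c"
      unfolding adj \<phi> [OF M(1)] by (simp only: M(2))
    then have cM: "adjoint \<phi> c \<bullet> (M *v x) \<noteq> 0"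
      using c(2) by simp
    have "matexp (t *\<^sub>R A) *v x \<in> top_of_set (cyclic_subspace A x) interior_of orbit_hull A x 0 T"
      using cut t by (simp add: cut_tail_point_def)
    from orbit_in_interior_imp [OF this Mx cM] obtain s where s: "0 \<le> s" "s \<le> T"
      "\<bar>adjoint \<phi> c \<bullet> (matexp (s *\<^sub>R A) *v x)\<bar> > adjoint \<phi> c \<bullet> (matexp (t *\<^sub>R A) *v x)"
      by blast
    then show False
      using c(3) [OF s(1,2)] by (simp add: adj \<phi> matexp_in_matpow_span)
  qed
qed

text \<open>The minimum for one base point is the \<open>LEAST\<close> over all of them, by
  independence of the base point.\<close>

lemma T_cut_cut_tail_point:
  assumes "hurwitz A"
  obtains x where "faithful_point A x" "cut_tail_point A x (T_cut A)"
proof -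
  obtain x where x: "base_point A x" by (rule ex_base_point)
  then have faithful: "faithful_point A x" by (rule base_point_imp_faithful)
  obtain T where T: "cut_tail_point A x T" "\<And>T'. cut_tail_point A x T' \<Longrightarrow> T \<le> T'"
    using ex_least_cut_tail_point [OF assms] by blast
  have "T_cut A = T"
    unfolding T_cut_def
  proof (rule Least_equality)
    show "\<exists>x. base_point A x \<and> cut_tail_point A x T" using x T(1) by blast
    fix T' assume "\<exists>x. base_point A x \<and> cut_tail_point A x T'"
    then show "T \<le> T'"
      using cut_tail_point_independent base_point_imp_faithful T(2) by blast
  qed
  with T(1) faithful that show ?thesis by blast
qed

proposition matexp_in_hull_up_to_T_cut:
  assumes "hurwitz A" "t \<ge> 0"
  shows "matexp (t *\<^sub>R A) \<in> convex hull ((\<lambda>s. matexp (s *\<^sub>R A)) ` {0..min t (T_cut A)} \<union>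
     uminus ` (\<lambda>s. matexp (s *\<^sub>R A)) ` {0..min t (T_cut A)})"
    (is "_ \<in> convex hull (?E \<union> uminus ` ?E)")
proof (cases "t \<le> T_cut A")
  case True
  then have "matexp (t *\<^sub>R A) \<in> ?E" using assms(2) by (intro imageI) simp
  then show ?thesis by (intro hull_inc UnI1)
next
  case False
  obtain x where x: "faithful_point A x" "cut_tail_point A x (T_cut A)"
    using T_cut_cut_tail_point [OF assms(1)] by blast
  have "matexp (t *\<^sub>R A) *v x \<in> top_of_set (cyclic_subspace A x) interior_of orbit_hull A x 0 (T_cut A)"
    using x(2) False unfolding cut_tail_point_def by simp
  then have "matexp (t *\<^sub>R A) *v x \<in> orbit_hull A x 0 (T_cut A)"
    by (rule subsetD [OF interior_of_subset])
  also have "orbit_hull A x 0 (T_cut A) = convex hull ((\<lambda>M. M *v x) ` (?E \<union> uminus ` ?E))"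
    using False unfolding orbit_hull_def sym_convex_hull_def
    by (simp add: image_Un image_image matrix_vector_mult_uminus)
  also have "\<dots> = (\<lambda>M. M *v x) ` (convex hull (?E \<union> uminus ` ?E))"
    by (rule convex_hull_linear_image [OF linear_matrix_vector_mult_left, symmetric])
  finally obtain M where M: "M \<in> convex hull (?E \<union> uminus ` ?E)" "matexp (t *\<^sub>R A) *v x = M *v x"
    by (rule imageE)
  \<comment> \<open>Faithfulness tests only matrices in the algebra of \<open>A\<close>, so the hull
    has to be placed there.\<close>
  have "convex hull (?E \<union> uminus ` ?E) \<subseteq> matpow_span A"
  proof (intro hull_minimal subspace_imp_convex subspace_span Un_least)
    show E: "?E \<subseteq> matpow_span A" using matexp_in_matpow_span by blast
    show "uminus ` ?E \<subseteq> matpow_span A" using E span_neg by blast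
  qed
  with M(1) have "matexp (t *\<^sub>R A) - M \<in> matpow_span A"
    by (intro span_diff matexp_in_matpow_span) (rule subsetD)
  moreover have "(matexp (t *\<^sub>R A) - M) *v x = 0"
    using M(2) by (simp add: matrix_vector_mult_diff_rdistrib)
  ultimately have "matexp (t *\<^sub>R A) - M = 0"
    using x(1) unfolding faithful_point_def by blast
  then have "matexp (t *\<^sub>R A) = M" by (simp only: right_minus_eq)
  with M(1) show ?thesis by (simp only:)
qed

end

section \<open>Words of matrices\<close>

text \<open>The new factor stands on the right and hence acts before the others, which suits peeling
  off the letter applied to a vector. Trajectories add letters on the left, see
  \<open>words_Suc_left\<close>.\<close>

primrec words :: "(real^'n^'n) set \<Rightarrow> nat \<Rightarrow> (real^'n^'n) set" where
  "words S 0 = {mat 1}"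
| "words S (Suc k) = {M ** P |M P. M \<in> words S k \<and> P \<in> S}"

lemma words_bound:
  assumes "\<And>P x. P \<in> S \<Longrightarrow> norm (P *v x) \<le> C * norm x" "C \<ge> 0" "M \<in> words S k"
  shows "norm (M *v x) \<le> C ^ k * norm x"
  using assms(3)
proof (induction k arbitrary: M x)
  case (Suc k)
  then obtain M' P where M: "M = M' ** P" "M' \<in> words S k" "P \<in> S" by auto
  have "norm (M *v x) = norm (M' *v (P *v x))" by (simp add: M matrix_vector_mul_assoc)
  also have "\<dots> \<le> C ^ k * norm (P *v x)" by (rule Suc.IH [OF M(2)])
  also have "\<dots> \<le> C ^ k * (C * norm x)" using assms M by (intro mult_left_mono) auto
  finally show ?case by (simp add: mult_ac)
qed simp

lemma words_Suc_left:
  assumes "M \<in> words S k" "P \<in> S"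
  shows "P ** M \<in> words S (Suc k)"
  using assms
proof (induction k arbitrary: M)
  case 0
  then show ?case by simp
next
  case (Suc k)
  then obtain M' Q where M: "M = M' ** Q" "M' \<in> words S k" "Q \<in> S" by auto
  then have "P ** M' \<in> words S (Suc k)" using Suc by blast
  then show ?case
    using M by (simp add: matrix_mul_assoc [symmetric]) (metis matrix_mul_assoc)
qed

lemma words_split:
  assumes "M \<in> words S (j + k)"
  obtains M1 M2 where "M = M1 ** M2" "M1 \<in> words S j" "M2 \<in> words S k"
proof -
  have "\<exists>M1 M2. M = M1 ** M2 \<and> M1 \<in> words S j \<and> M2 \<in> words S k"
    using assms
  proof (induction k arbitrary: M)
    case 0
    then show ?case by (intro exI [of _ M] exI [of _ "mat 1"]) simp
  next
    case (Suc k)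
    then obtain M' P where M: "M = M' ** P" "M' \<in> words S (j + k)" "P \<in> S" by auto
    then obtain M1 M2 where "M' = M1 ** M2" "M1 \<in> words S j" "M2 \<in> words S k"
      using Suc.IH by blast
    with M show ?case
      by (intro exI [of _ M1] exI [of _ "M2 ** P"]) (auto simp: matrix_mul_assoc)
  qed
  with that show ?thesis by blast
qed

text \<open>Division of the length by \<open>N\<close> yields blocks that halve the norm and a
  remainder that costs at most C^N.\<close>

lemma words_decay:
  fixes S :: "(real^'n^'n) set"
  assumes bound: "\<And>P x. P \<in> S \<Longrightarrow> norm (P *v x) \<le> C * norm x" "C \<ge> 1"
    and half: "\<And>M x. M \<in> words S N \<Longrightarrow> norm (M *v x) \<le> norm x / 2"
    and "e > 0"
  shows "\<exists>n. \<forall>k\<ge>n. \<forall>M\<in>words S k. \<forall>x. norm (M *v x) \<le> e * norm x"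
proof -
  have step: "norm (M *v x) \<le> C ^ r * norm x / 2 ^ q" if "M \<in> words S (q * N + r)" for q r M x
    using that
  proof (induction q arbitrary: M)
    case 0
    then show ?case using words_bound [OF bound(1), of S M r] bound(2) by simp
  next
    case (Suc q)
    then have "M \<in> words S (N + (q * N + r))" by (simp add: add.assoc)
    then obtain M1 M2 where M: "M = M1 ** M2" "M1 \<in> words S N" "M2 \<in> words S (q * N + r)"
      by (rule words_split)
    have "norm (M *v x) \<le> norm (M2 *v x) / 2"
      using half [OF M(2), of "M2 *v x"] by (simp add: M(1) matrix_vector_mul_assoc)
    also have "\<dots> \<le> (C ^ r * norm x / 2 ^ q) / 2"
      using Suc.IH [OF M(3)] by simp
    finally show ?case by simp
  qed
  have "(\<lambda>q. C ^ N / 2 ^ q) \<longlonglongrightarrow> 0"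
    using tendsto_mult_right_zero [OF LIMSEQ_inverse_realpow_zero [of 2], of "C ^ N"]
    by (simp add: divide_inverse)
  then have "\<forall>\<^sub>F q in sequentially. C ^ N / 2 ^ q < e"
    using \<open>e > 0\<close> by (rule order_tendstoD)
  then obtain q0 where q0: "\<And>q. q \<ge> q0 \<Longrightarrow> C ^ N / 2 ^ q < e"
    by (auto simp: eventually_sequentially)
  show ?thesis
  \<comment> \<open>For \<open>N = 0\<close> the only word is the identity, and halving leaves no
    vector but 0.\<close>
  proof (cases "N = 0")
    case True
    then have zero: "x = 0" for x :: "real^'n"
      using half [of "mat 1" x] by simp
    have "norm (M *v x) \<le> e * norm x" for M :: "real^'n^'n" and x
      using \<open>e > 0\<close> by (simp add: zero [of "M *v x"])
    then show ?thesis by blast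
  next
    case False
    show ?thesis
    proof (intro exI [of _ "q0 * N"] allI impI ballI)
      fix k M and x :: "real^'n" assume k: "q0 * N \<le> k" "M \<in> words S k"
      define q r where "q = k div N" and "r = k mod N"
      have kqr: "k = q * N + r" by (simp add: q_def r_def)
      have "q0 \<le> q" using k(1) False by (simp add: q_def less_eq_div_iff_mult_less_eq)
      have "norm (M *v x) \<le> C ^ r * norm x / 2 ^ q" using step k(2) kqr by blast
      also have "\<dots> = (C ^ r / 2 ^ q) * norm x" by simp
      also have "\<dots> \<le> (C ^ N / 2 ^ q) * norm x"
        using bound(2) False
        by (intro mult_right_mono divide_right_mono power_increasing) (auto simp: r_def less_imp_le)
      also have "\<dots> \<le> e * norm x"
        using q0 [OF \<open>q0 \<le> q\<close>] by (intro mult_right_mono) auto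
      finally show "norm (M *v x) \<le> e * norm x" .
    qed
  qed
qed

text \<open>An extremal seminorm of Barabanov type exists when the words do not contract. The factor \<open>k + 1\<close>
  makes the suprema \<open>N n\<close> of \<open>(k + 1) \<parallel>M\<parallel>\<close> over words \<open>M\<close> of length \<open>k \<le> n\<close>
  tend to infinity, so that short words are negligible in the upper limit \<open>v\<close>
  of the normalised norms.\<close>

proposition ex_extremal_seminorm:
  fixes S :: "(real^'n^'n) set"
  assumes bound: "\<And>P x. P \<in> S \<Longrightarrow> norm (P *v x) \<le> C * norm x" and C: "C \<ge> 1"
    and neg: "\<And>k. \<exists>M\<in>words S k. \<exists>x. norm (M *v x) > norm x / 2"
  obtains v :: "real^'n \<Rightarrow> real" where
    "\<And>x y. v (x + y) \<le> v x + v y" "\<And>a x. v (a *\<^sub>R x) \<le> \<bar>a\<bar> * v x"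
    "\<And>x. 0 \<le> v x" "\<And>x. v x \<le> norm x" "\<exists>x. v x > 0"
    "\<And>x c. 0 < c \<Longrightarrow> c < v x \<Longrightarrow> \<exists>P\<in>S. c < v (P *v x)"
proof -
  define X where "X n = {(real k + 1) * norm (M *v x) |k M x. k \<le> n \<and> M \<in> words S k \<and> norm x \<le> 1}" for n
  define N where "N n = Sup (X n)" for n
  have wb: "norm (M *v x) \<le> C ^ k * norm x" if "M \<in> words S k" for M k x
    by (rule words_bound [OF bound _ that]) (use C in auto)
  have "bdd_above (X n)" for n
  proof (rule bdd_aboveI [of _ "(real n + 1) * C ^ n"])
    fix r assume "r \<in> X n"
    then obtain k M x where r: "r = (real k + 1) * norm (M *v x)" "k \<le> n" "M \<in> words S k" "norm x \<le> 1"
      by (auto simp: X_def)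
    have "norm (M *v x) \<le> C ^ k * norm x" using wb r(3) .
    also have "\<dots> \<le> C ^ n * 1" using C r by (intro mult_mono power_increasing) auto
    finally show "r \<le> (real n + 1) * C ^ n" unfolding r(1) using r(2) by (intro mult_mono) auto
  qed
  then have N_upper: "(real k + 1) * norm (M *v x) \<le> N n" if "k \<le> n" "M \<in> words S k" "norm x \<le> 1" for n k M x
    unfolding N_def using that by (intro cSup_upper) (auto simp: X_def)
  have N_ge: "N n \<ge> (real n + 1) / 2" for n
  proof -
    obtain M x where M: "M \<in> words S n" "norm (M *v x) > norm x / 2" using neg by blast
    then have "x \<noteq> 0" by auto
    have "1 / 2 \<le> norm (M *v (x /\<^sub>R norm x))"
      using M(2) \<open>x \<noteq> 0\<close> by (simp add: matrix_vector_mult_scaleR field_simps)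
    from mult_left_mono [OF this, of "real n + 1"]
    have "(real n + 1) / 2 \<le> (real n + 1) * norm (M *v (x /\<^sub>R norm x))" by simp
    also have "\<dots> \<le> N n" using M(1) \<open>x \<noteq> 0\<close> by (intro N_upper) auto
    finally show ?thesis .
  qed
  then have N_pos: "N n > 0" for n
    by (meson add_nonneg_pos half_gt_zero less_le_trans of_nat_0_le_iff zero_less_one)
  have N_lim: "\<forall>\<^sub>F n in sequentially. Z \<le> N n" for Z
    using eventually_ge_at_top [of "nat \<lceil>2 * Z\<rceil>"]
  proof eventually_elim
    case (elim n)
    then have "2 * Z \<le> real n" by linarith
    then have "Z \<le> (real n + 1) / 2" by simp
    also have "\<dots> \<le> N n" by (rule N_ge)
    finally show ?case .
  qed
  \<comment> \<open>The weighted norms at \<open>x\<close>, divided by \<open>N n\<close>, are at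
    most \<open>c\<close>. Working with bounds instead of suprema reduces subadditivity and
    homogeneity to adding and scaling bounds.\<close>
  define B where "B n x c \<longleftrightarrow> (\<forall>k\<le>n. \<forall>M\<in>words S k. (real k + 1) * norm (M *v x) \<le> c * N n)" for n x c
  have B_norm: "B n x (norm x)" for n x
    unfolding B_def
  proof (intro allI impI ballI)
    fix k M assume kM: "k \<le> n" "M \<in> words S k"
    show "(real k + 1) * norm (M *v x) \<le> norm x * N n"
    proof (cases "x = 0")
      case False
      then have "(real k + 1) * norm (M *v (x /\<^sub>R norm x)) \<le> N n" using kM by (intro N_upper) auto
      with False show ?thesis by (simp add: matrix_vector_mult_scaleR field_simps)
    qed simp
  qed
  have B_mono: "B n x d" if "B n x c" "c \<le> d" for n x c d
    unfolding B_def
  proof (intro allI impI ballI)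
    fix k M assume "k \<le> n" "M \<in> words S k"
    then have "(real k + 1) * norm (M *v x) \<le> c * N n" using that(1) by (simp add: B_def)
    also have "\<dots> \<le> d * N n" using that(2) N_pos [of n] by simp
    finally show "(real k + 1) * norm (M *v x) \<le> d * N n" .
  qed
  have B_add: "B n (x + y) (c + d)" if "B n x c" "B n y d" for n x y c d
    unfolding B_def
  proof (intro allI impI ballI)
    fix k M assume kM: "k \<le> n" "M \<in> words S k"
    have "(real k + 1) * norm (M *v (x + y)) \<le> (real k + 1) * (norm (M *v x) + norm (M *v y))"
      by (intro mult_left_mono) (simp_all add: matrix_vector_right_distrib norm_triangle_ineq)
    also have "\<dots> \<le> c * N n + d * N n"
      using that kM unfolding B_def by (simp add: distrib_left add_mono)
    finally show "(real k + 1) * norm (M *v (x + y)) \<le> (c + d) * N n" by (simp add: distrib_right)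
  qed
  have B_scale: "B n (a *\<^sub>R x) (\<bar>a\<bar> * c)" if "B n x c" for n a x c
    unfolding B_def
  proof (intro allI impI ballI)
    fix k M assume "k \<le> n" "M \<in> words S k"
    then have "(real k + 1) * norm (M *v x) \<le> c * N n" using that by (simp add: B_def)
    from mult_left_mono [OF this, of "\<bar>a\<bar>"]
    show "(real k + 1) * norm (M *v (a *\<^sub>R x)) \<le> \<bar>a\<bar> * c * N n"
      by (simp add: matrix_vector_mult_scaleR mult_ac)
  qed
  \<comment> \<open>The infimum of the eventual bounds is the upper limit over n of the normalised
    maxima.\<close>
  define V where "V x = {c. 0 \<le> c \<and> (\<forall>\<^sub>F n in sequentially. B n x c)}" for x
  define v where "v x = Inf (V x)" for x
  have V_norm: "norm x \<in> V x" for x by (simp add: V_def B_norm)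
  have V_bdd: "bdd_below (V x)" for x by (rule bdd_belowI [of _ 0]) (simp add: V_def)
  have v_le: "v x \<le> c" if "c \<in> V x" for x c
    unfolding v_def by (rule cInf_lower [OF that V_bdd])
  have v_ge: "c \<le> v x" if "\<exists>\<^sub>F n in sequentially. \<not> B n x c" for x c
    unfolding v_def
  proof (rule cInf_greatest)
    show "V x \<noteq> {}" using V_norm by blast
    fix d assume d: "d \<in> V x"
    show "c \<le> d"
    proof (rule ccontr)
      assume "\<not> c \<le> d"
      then have "\<forall>\<^sub>F n in sequentially. B n x c"
        using d B_mono [of _ x d c] by (auto simp: V_def elim!: eventually_mono)
      with that show False by (simp add: frequently_def)
    qed
  qed
  have v_gt: "\<exists>\<^sub>F n in sequentially. \<not> B n x c" if "c < v x" "0 \<le> c" for x c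
    using that v_le [of c x] unfolding V_def frequently_def by force
  have v_approx: "\<exists>c\<in>V x. c < v x + e" if "e > 0" for x e
    using cInf_lessD [of "V x" "v x + e"] V_norm [of x] that by (auto simp: v_def)
  \<comment> \<open>A finite \<delta>-net replaces \<open>Z\<close>: moving to a net point changes
    the normalised maximum by at most \<delta>, and one of finitely many net points occurs for
    infinitely many n.\<close>
  have pigeonhole: "\<exists>z\<in>Z. c - \<delta> \<le> v z"
    if freq: "\<exists>\<^sub>F n in sequentially. \<exists>z\<in>Z. \<not> B n z c" and Z: "bounded Z" and \<delta>: "\<delta> > 0" for Z c \<delta>
  proof -
    obtain F where F: "F \<subseteq> Z" "finite F" "Z \<subseteq> (\<Union>z\<in>F. ball z \<delta>)"
    proof (rule compactE_image [of "closure Z" Z "\<lambda>z. ball z \<delta>"])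
      show "compact (closure Z)" using Z by simp
      show "closure Z \<subseteq> (\<Union>z\<in>Z. ball z \<delta>)"
        using \<delta> by (auto simp: closure_approachable)
      show ?thesis if "F \<subseteq> Z" "finite F" "closure Z \<subseteq> (\<Union>z\<in>F. ball z \<delta>)" for F
        using that(3) closure_subset [of Z] by (intro \<open>\<And>F. \<lbrakk>F \<subseteq> Z; finite F; Z \<subseteq> (\<Union>z\<in>F. ball z \<delta>)\<rbrakk> \<Longrightarrow> thesis\<close> [OF that(1,2)]) blast
    qed auto
    have "\<exists>z\<in>F. \<not> B n z (c - \<delta>)" if ex: "\<exists>z\<in>Z. \<not> B n z c" for n
    proof -
      obtain w where w: "w \<in> Z" "\<not> B n w c" using ex by blast
      obtain z where z: "z \<in> F" "dist z w < \<delta>" using F(3) w(1) by auto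
      have "B n (w - z) \<delta>"
        using B_mono [OF B_norm [of n "w - z"]] z(2) by (simp add: dist_norm norm_minus_commute)
      then have "\<not> B n z (c - \<delta>)"
        using B_add [of n z "c - \<delta>" "w - z" \<delta>] w(2) by auto
      with z(1) show ?thesis by blast
    qed
    with freq have "\<exists>\<^sub>F n in sequentially. \<exists>z\<in>F. \<not> B n z (c - \<delta>)"
      by (rule frequently_elim1)
    from frequently_bex_finite [OF F(2) this]
    obtain z where "z \<in> F" "\<exists>\<^sub>F n in sequentially. \<not> B n z (c - \<delta>)"
      by blast
    with F(1) v_ge show ?thesis by blast
  qed
  show ?thesis
  proof (rule that [of v])
    show "0 \<le> v x" for x
      unfolding v_def
    proof (rule cInf_greatest)
      show "V x \<noteq> {}" using V_norm by blast
    qed (simp add: V_def)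
    show "v x \<le> norm x" for x by (rule v_le [OF V_norm])
    show "v (x + y) \<le> v x + v y" for x y
    proof (rule field_le_epsilon)
      fix e :: real assume "e > 0"
      then obtain c d where "c \<in> V x" "c < v x + e / 2" "d \<in> V y" "d < v y + e / 2"
        using v_approx [of "e / 2" x] v_approx [of "e / 2" y] by auto
      moreover from this have "c + d \<in> V (x + y)"
        using B_add by (auto simp: V_def elim: eventually_elim2)
      ultimately show "v (x + y) \<le> v x + v y + e" using v_le by fastforce
    qed
    show "v (a *\<^sub>R x) \<le> \<bar>a\<bar> * v x" for a x
    proof (cases "a = 0")
      case True
      then show ?thesis using v_le [OF V_norm [of 0]] by simp
    next
      case False
      have "v (a *\<^sub>R x) / \<bar>a\<bar> \<le> c" if "c \<in> V x" for c
      proof -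
        have "\<bar>a\<bar> * c \<in> V (a *\<^sub>R x)"
          using that B_scale by (auto simp: V_def elim!: eventually_mono)
        from v_le [OF this] False show ?thesis by (simp add: field_simps)
      qed
      then have "v (a *\<^sub>R x) / \<bar>a\<bar> \<le> v x"
        unfolding v_def [of x] using V_norm by (intro cInf_greatest) auto
      with False show ?thesis by (simp add: field_simps)
    qed
    \<comment> \<open>Some point of the unit ball realises more than half of \<open>N n\<close>. A
      net of mesh 1/4 then leaves a point with v at least 1/4, so v is not zero.\<close>
    have "\<exists>x\<in>cball 0 1. \<not> B n x (1/2)" for n
    proof -
      have "(real 0 + 1) * norm (mat 1 *v (0 :: real^'n)) \<in> X n"
        unfolding X_def
        by (rule CollectI, rule exI [of _ 0], rule exI [of _ "mat 1"], rule exI [of _ 0]) simp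
      then have ne: "X n \<noteq> {}" by blast
      have "N n / 2 < N n" using N_pos [of n] by simp
      then obtain r where "r \<in> X n" "N n / 2 < r"
        unfolding N_def using less_cSupD [OF ne] by blast
      then show ?thesis
        unfolding X_def B_def by (force simp: not_le)
    qed
    then have "\<exists>x\<in>cball 0 1. 1/2 - 1/4 \<le> v x"
      by (intro pigeonhole always_eventually [THEN eventually_frequently [OF sequentially_bot]]) auto
    then obtain x where "1/2 - 1/4 \<le> v x" by blast
    then have "0 < v x" by simp
    then show "\<exists>x. v x > 0" by blast
    fix x and c :: real assume c: "0 < c" "c < v x"
    \<comment> \<open>Three levels between c and v(x): the step to \<open>c2\<close> pays for the
      change of weight, the step to \<open>c3\<close> for the net, and the last gap keeps the
      inequality strict.\<close>
    obtain c1 where c1: "c < c1" "c1 < v x" using c(2) dense by blast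
    obtain c2 where c2: "c < c2" "c2 < c1" using c1(1) dense by blast
    obtain c3 where c3: "c < c3" "c3 < c2" using c2(1) dense by blast
    have cs: "c1 < v x" "c2 < c1" "0 < c1" "0 < c2" using c c1 c2 by auto
    \<comment> \<open>Removing a letter changes the weight from k + 1 to k; beyond this
      \<open>K\<close> the loss is covered by the gap between \<open>c1\<close> and
      \<open>c2\<close>.\<close>
    obtain K :: nat where "c2 / (c1 - c2) < real K" using reals_Archimedean2 by blast
    then have K: "c2 * (real K + 1) < c1 * real K" using cs by (simp add: field_simps)
    have "\<forall>\<^sub>F n in sequentially. (real K + 1) * (C ^ K * norm x) / c1 \<le> N n"
      by (rule N_lim)
    then have "\<forall>\<^sub>F n in sequentially. \<not> B n x c1 \<longrightarrow>
        \<not> B n x c1 \<and> (real K + 1) * (C ^ K * norm x) / c1 \<le> N n"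
      by (rule eventually_mono) blast
    with v_gt [OF cs(1) less_imp_le [OF cs(3)]]
    have "\<exists>\<^sub>F n in sequentially. \<not> B n x c1 \<and> (real K + 1) * (C ^ K * norm x) / c1 \<le> N n"
      by (rule frequently_rev_mp)
    then have "\<exists>\<^sub>F n in sequentially. \<exists>z\<in>(\<lambda>P. P *v x) ` S. \<not> B n z c2"
    proof (rule frequently_elim1)
      fix n assume n: "\<not> B n x c1 \<and> (real K + 1) * (C ^ K * norm x) / c1 \<le> N n"
      then obtain k M where kM: "k \<le> n" "M \<in> words S k" "(real k + 1) * norm (M *v x) > c1 * N n"
        unfolding B_def by (auto simp: not_le)
      \<comment> \<open>Words of length at most \<open>K\<close> have bounded weighted norms at
        \<open>x\<close>, which the large \<open>N n\<close> dominates.\<close>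
      have "k > K"
      proof (rule ccontr)
        assume "\<not> k > K"
        then have "C ^ k * norm x \<le> C ^ K * norm x"
          using C by (intro mult_right_mono power_increasing) auto
        then have "(real k + 1) * norm (M *v x) \<le> (real K + 1) * (C ^ K * norm x)"
          using wb [OF kM(2), of x] \<open>\<not> k > K\<close> by (intro mult_mono) auto
        also have "\<dots> \<le> c1 * N n" using n cs by (simp add: field_simps)
        finally show False using kM(3) by simp
      qed
      then obtain j where j: "k = Suc j" using gr0_implies_Suc by fastforce
      then obtain M' P where M: "M = M' ** P" "M' \<in> words S j" "P \<in> S" using kM(2) by auto
      have "c2 * (real k + 1) \<le> c1 * real k"
      proof -
        have "(c1 - c2) * real K \<le> (c1 - c2) * real k" using cs \<open>k > K\<close> by simp
        then show ?thesis using K by (simp add: algebra_simps)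
      qed
      then have "c2 * N n * (real k + 1) \<le> c1 * N n * real k"
        using N_pos [of n] by (simp add: mult.commute mult.left_commute)
      also have "\<dots> < (real k + 1) * norm (M *v x) * real k"
        using kM(3) j by (intro mult_strict_right_mono) auto
      finally have "c2 * N n < real k * norm (M *v x)"
        by (simp add: mult.commute mult.left_commute)
      then have "\<not> B n (P *v x) c2"
        unfolding B_def using M j kM(1)
        by (auto simp: not_le matrix_vector_mul_assoc add.commute intro!: exI [of _ j] bexI [of _ M'])
      with M(3) show "\<exists>z\<in>(\<lambda>P. P *v x) ` S. \<not> B n z c2" by blast
    qed
    moreover have "bounded ((\<lambda>P. P *v x) ` S)"
      using bound by (auto simp: bounded_iff)
    moreover have "0 < c2 - c3" using c3 by simp
    ultimately have "\<exists>z\<in>(\<lambda>P. P *v x) ` S. c2 - (c2 - c3) \<le> v z"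
      by (rule pigeonhole)
    then obtain P where "P \<in> S" "c3 \<le> v (P *v x)" by auto
    with c3(1) show "\<exists>P\<in>S. c < v (P *v x)" by (intro bexI [of _ P]) auto
  qed
qed

section \<open>Contraction of long words\<close>

definition letters :: "(real^'n^'n) set \<Rightarrow> (real^'n^'n \<Rightarrow> real) \<Rightarrow> (real^'n^'n) set" where
  "letters \<A> m = {matexp (t *\<^sub>R A) |A t. A \<in> \<A> \<and> m A \<le> t}"

definition restricted_dwell ::
    "(real^'n^'n) set \<Rightarrow> (real^'n^'n \<Rightarrow> real) \<Rightarrow> real^'n^'n \<Rightarrow> real \<Rightarrow> bool" where
  "restricted_dwell J m A s \<longleftrightarrow> m A \<le> s \<and> (A \<in> J \<longrightarrow> s \<le> m A + T_cut A)"

text \<open>The matrices \<open>M\<close> with \<open>v (L M x) \<le> c\<close> form a symmetric convex set.\<close>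

lemma ex_restricted_dwell_ge:
  fixes v :: "real^'n \<Rightarrow> real"
  assumes v: "\<And>x y. v (x + y) \<le> v x + v y" "\<And>a x. v (a *\<^sub>R x) \<le> \<bar>a\<bar> * v x"
    and A: "hurwitz A" and t: "m A \<le> t" and c: "c < v (L *v (matexp (t *\<^sub>R A) *v x))"
  shows "\<exists>s. restricted_dwell J m A s \<and> c < v (L *v (matexp (s *\<^sub>R A) *v x))"
proof (rule ccontr)
  assume neg: "\<not> ?thesis"
  \<comment> \<open>The mandatory dwell \<open>m A\<close> is absorbed into \<open>w\<close>; only
    the excess \<open>u\<close> is cut, to at most \<open>T_cut A\<close>.\<close>
  define u where "u = t - m A"
  have u: "u \<ge> 0" using t by (simp add: u_def)
  define w where "w = matexp (m A *\<^sub>R A) *v x"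
  have split: "matexp ((r + m A) *\<^sub>R A) *v x = matexp (r *\<^sub>R A) *v w" if "r \<ge> 0" for r
    using matexp_add [OF that, of "m A" A] by (simp add: w_def matrix_vector_mul_assoc)
  define Q where "Q = {M. v (L *v (M *v w)) \<le> c}"
  define E where "E = (\<lambda>s. matexp (s *\<^sub>R A)) ` {0..min u (T_cut A)}"
  have "convex Q"
  proof (rule convexI)
    fix M1 M2 and a b :: real
    assume M: "M1 \<in> Q" "M2 \<in> Q" and ab: "0 \<le> a" "0 \<le> b" "a + b = 1"
    have "v (L *v ((a *\<^sub>R M1 + b *\<^sub>R M2) *v w)) = v (a *\<^sub>R (L *v (M1 *v w)) + b *\<^sub>R (L *v (M2 *v w)))"
      by (simp add: matrix_vector_mult_add_rdistrib matrix_vector_right_distrib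
          scaleR_matrix_vector_assoc [symmetric] matrix_vector_mult_scaleR)
    also have "\<dots> \<le> v (a *\<^sub>R (L *v (M1 *v w))) + v (b *\<^sub>R (L *v (M2 *v w)))" by (rule v(1))
    also have "\<dots> \<le> a * v (L *v (M1 *v w)) + b * v (L *v (M2 *v w))"
      using v(2) [of a] v(2) [of b] ab by (intro add_mono) simp_all
    also have "\<dots> \<le> a * c + b * c"
      using M ab by (intro add_mono mult_left_mono) (auto simp: Q_def)
    also have "\<dots> = c" using ab by (simp flip: distrib_right)
    finally show "a *\<^sub>R M1 + b *\<^sub>R M2 \<in> Q" by (simp add: Q_def)
  qed
  moreover have "E \<subseteq> Q"
  proof
    fix M assume "M \<in> E"
    then obtain r where r: "0 \<le> r" "r \<le> u" "r \<le> T_cut A" "M = matexp (r *\<^sub>R A)" by (auto simp: E_def)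
    have "restricted_dwell J m A (r + m A)" using r by (simp add: restricted_dwell_def)
    with neg have "\<not> c < v (L *v (matexp ((r + m A) *\<^sub>R A) *v x))" by blast
    then show "M \<in> Q" using split [OF r(1)] r(4) by (simp add: Q_def)
  qed
  moreover have "- M \<in> Q" if "M \<in> Q" for M
  proof -
    have "v (L *v ((- M) *v w)) = v ((- 1) *\<^sub>R (L *v (M *v w)))"
      by (simp add: matrix_vector_mult_uminus linear_neg [OF matrix_vector_mul_linear])
    also have "\<dots> \<le> \<bar>- 1\<bar> * v (L *v (M *v w))" by (rule v(2))
    finally show ?thesis using that by (simp add: Q_def)
  qed
  ultimately have "convex hull (E \<union> uminus ` E) \<subseteq> Q"
    by (intro hull_minimal) auto
  moreover have "matexp (u *\<^sub>R A) \<in> convex hull (E \<union> uminus ` E)"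
    unfolding E_def by (rule matexp_in_hull_up_to_T_cut [OF A u])
  ultimately have "matexp (u *\<^sub>R A) \<in> Q" by blast
  then have "v (L *v (matexp (t *\<^sub>R A) *v x)) \<le> c"
    using split [OF u] by (simp add: Q_def u_def)
  with c show False by simp
qed

text \<open>The construction looks one letter ahead: \<open>good x A t\<close> says that v exceeds c
  after the pending letter exp(tA), not at \<open>x\<close> itself. The pending letter is cut once
  its successor is known, and the successor becomes the new pending letter.\<close>

proposition restricted_stable_imp_contracting:
  fixes \<A> J :: "(real^'n^'n) set" and m :: "real^'n^'n \<Rightarrow> real"
  assumes hur: "\<And>A. A \<in> \<A> \<Longrightarrow> hurwitz A" and m: "\<And>A. A \<in> \<A> \<Longrightarrow> 0 < m A"
    and C: "C \<ge> 1" "\<And>A t x. A \<in> \<A> \<Longrightarrow> t \<ge> 0 \<Longrightarrow> norm (matexp (t *\<^sub>R A) *v x) \<le> C * norm x"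
    and stable: "\<And>A s y. (\<And>j :: nat. A j \<in> \<A> \<and> restricted_dwell J m (A j) (s j) \<and> A (Suc j) \<noteq> A j
        \<and> y (Suc j) = matexp (s j *\<^sub>R A j) *v y j) \<Longrightarrow> y \<longlonglongrightarrow> 0"
  shows "\<exists>N. \<forall>M\<in>words (letters \<A> m) N. \<forall>x. norm (M *v x) \<le> norm x / 2"
proof (rule ccontr)
  assume "\<not> ?thesis"
  then have neg: "\<exists>M\<in>words (letters \<A> m) k. \<exists>x. norm (M *v x) > norm x / 2" for k
    by (meson not_less)
  have bound: "norm (P *v x) \<le> C * norm x" if "P \<in> letters \<A> m" for P x
    using that C(2) m unfolding letters_def by (force intro: less_imp_le less_le_trans)
  obtain v :: "real^'n \<Rightarrow> real" where v: "\<And>x y. v (x + y) \<le> v x + v y" "\<And>a x. v (a *\<^sub>R x) \<le> \<bar>a\<bar> * v x"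
    "\<And>x. 0 \<le> v x" "\<And>x. v x \<le> norm x" "\<exists>x. v x > 0"
    "\<And>x c. 0 < c \<Longrightarrow> c < v x \<Longrightarrow> \<exists>P\<in>letters \<A> m. c < v (P *v x)"
    by (rule ex_extremal_seminorm [OF bound C(1) neg]) blast+
  obtain x0 where "v x0 > 0" using v(5) by blast
  then obtain c where c: "0 < c" "c < v x0" using dense by blast
  define good where "good x A t \<longleftrightarrow> A \<in> \<A> \<and> m A \<le> t \<and> c < v (matexp (t *\<^sub>R A) *v x)" for x A t
  have ex_good: "\<exists>A t. good x A t" if "c < v x" for x
    using v(6) [OF c(1) that] unfolding letters_def good_def by blast
  have step: "\<exists>s A' t'. restricted_dwell J m A s \<and> A' \<noteq> A \<and> good (matexp (s *\<^sub>R A) *v x) A' t'"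
    if g: "good x A t" for x A t
  proof -
    have A: "A \<in> \<A>" "hurwitz A" "m A > 0" using g hur m by (auto simp: good_def)
    \<comment> \<open>All admissible durations of the regime that keep v above c. They are bounded,
      since v is at most the norm and the orbit decays.\<close>
    define T where "T = {r. m A \<le> r \<and> c < v (matexp (r *\<^sub>R A) *v x)}"
    have "t \<in> T" using g by (simp add: T_def good_def)
    have "\<forall>\<^sub>F r in at_top. norm (matexp (r *\<^sub>R A) *v x) < c"
      using tendstoD [OF hurwitz_matexp_mult_tendsto_0 [OF A(2)] c(1)] by simp
    then obtain R where R: "\<And>r. r \<ge> R \<Longrightarrow> norm (matexp (r *\<^sub>R A) *v x) < c"
      by (auto simp: eventually_at_top_linorder)
    have T_le: "r \<le> R" if "r \<in> T" for r
      using that R [of r] v(4) [of "matexp (r *\<^sub>R A) *v x"] by (force simp: T_def)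
    have bdd: "bdd_above T" by (rule bdd_aboveI [OF T_le])
    \<comment> \<open>From a duration this close to the supremum the same regime cannot continue:
      another dwell of at least \<open>m A\<close> would merge with it to an element of
      \<open>T\<close> above \<open>Sup T\<close>.\<close>
    have "Sup T - m A < Sup T" using A(3) by simp
    then obtain r where r: "r \<in> T" "Sup T - m A < r"
      using less_cSupD [of T "Sup T - m A"] \<open>t \<in> T\<close> by blast
    then have "c < v (matexp (r *\<^sub>R A) *v x)" by (simp add: T_def)
    from ex_good [OF this] obtain A' t' where A': "good (matexp (r *\<^sub>R A) *v x) A' t'"
      by blast
    have "A' \<noteq> A"
    proof
      assume "A' = A"
      then have t': "m A \<le> t'" "c < v (matexp (t' *\<^sub>R A) *v (matexp (r *\<^sub>R A) *v x))"
        using A' by (simp_all add: good_def)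
      have "matexp ((t' + r) *\<^sub>R A) = matexp (t' *\<^sub>R A) ** matexp (r *\<^sub>R A)"
        using t'(1) A(3) by (intro matexp_add) simp
      then have "t' + r \<in> T"
        using t' r(1) A(3) by (simp add: T_def matrix_vector_mul_assoc)
      then have "t' + r \<le> Sup T" by (intro cSup_upper bdd)
      with r(2) t'(1) show False by simp
    qed
    moreover have "m A \<le> r" using r(1) by (simp add: T_def)
    \<comment> \<open>The successor takes the place of \<open>L\<close>, so it is still good after
      the cut.\<close>
    then obtain s where "restricted_dwell J m A s"
      "c < v (matexp (t' *\<^sub>R A') *v (matexp (s *\<^sub>R A) *v x))"
      using ex_restricted_dwell_ge [OF v(1,2) A(2), of m r c "matexp (t' *\<^sub>R A')" x J] A'
      by (auto simp: good_def)
    ultimately show ?thesis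
      using A' unfolding good_def by blast
  qed
  obtain A0 t0 where "good x0 A0 t0" using ex_good [OF c(2)] by blast
  then have "\<exists>z. case z of (x, A, t) \<Rightarrow> good x A t" by blast
  then have "\<exists>f. \<forall>j :: nat. (case f j of (x, A, t) \<Rightarrow> good x A t) \<and>
      (case (f j, f (Suc j)) of ((x, A, t), (x', A', t')) \<Rightarrow>
        \<exists>s. restricted_dwell J m A s \<and> A' \<noteq> A \<and> x' = matexp (s *\<^sub>R A) *v x)"
  proof (rule dependent_nat_choice [where P = "\<lambda>_ z. case z of (x, A, t) \<Rightarrow> good x A t"])
    fix z :: "(real^'n) \<times> (real^'n^'n) \<times> real" assume "case z of (x, A, t) \<Rightarrow> good x A t"
    then show "\<exists>z'. (case z' of (x, A, t) \<Rightarrow> good x A t) \<and>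
        (case (z, z') of ((x, A, t), (x', A', t')) \<Rightarrow>
        \<exists>s. restricted_dwell J m A s \<and> A' \<noteq> A \<and> x' = matexp (s *\<^sub>R A) *v x)"
      using step by (cases z) fastforce
  qed
  then obtain f where f: "\<forall>j :: nat. (case f j of (x, A, t) \<Rightarrow> good x A t) \<and>
      (case (f j, f (Suc j)) of ((x, A, t), (x', A', t')) \<Rightarrow>
        \<exists>s. restricted_dwell J m A s \<and> A' \<noteq> A \<and> x' = matexp (s *\<^sub>R A) *v x)"
    by (rule exE)
  define y where "y j = fst (f j)" for j
  define B where "B j = fst (snd (f j))" for j
  have good: "good (y j) (B j) (snd (snd (f j)))" for j
    using f [rule_format, of j] by (simp add: y_def B_def split: prod.splits)
  have "\<exists>s. restricted_dwell J m (B j) s \<and> B (Suc j) \<noteq> B j \<and> y (Suc j) = matexp (s *\<^sub>R B j) *v y j" for j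
    using f [rule_format, of j] by (simp add: y_def B_def split: prod.splits)
  then obtain s where "\<And>j. restricted_dwell J m (B j) (s j) \<and> B (Suc j) \<noteq> B j \<and> y (Suc j) = matexp (s j *\<^sub>R B j) *v y j"
    by metis
  then have "y \<longlonglongrightarrow> 0"
    using good by (intro stable [of B s y]) (simp add: good_def)
  then have "\<forall>\<^sub>F j in sequentially. norm (y j) < c / C"
    using tendstoD [of y 0 sequentially "c / C"] c(1) C(1) by simp
  then obtain j where j: "norm (y j) < c / C"
    using eventually_happens' [OF sequentially_bot] by blast
  \<comment> \<open>v(y j) itself may be small; the pending letter, whose norm is at most
    \<open>C\<close>, keeps the norm of \<open>y j\<close> above c / C.\<close>
  have "c < norm (matexp (snd (snd (f j)) *\<^sub>R B j) *v y j)"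
    using good [of j] v(4) less_le_trans unfolding good_def by blast
  also have "\<dots> \<le> C * norm (y j)"
    using good [of j] m [of "B j"] by (intro C(2)) (auto simp: good_def)
  also have "\<dots> < c"
    using j C(1) by (simp add: field_simps)
  finally show False .
qed

section \<open>Trajectories and words\<close>

text \<open>A locally constant function on a connected interval is constant. Right continuity
  handles the left end, which may be a switching point.\<close>

lemma piecewise_constant_constant:
  assumes \<sigma>: "piecewise_constant \<sigma>" and a: "0 \<le> a"
    and no: "\<And>s. s \<in> switching_points \<sigma> \<Longrightarrow> \<not> (a < s \<and> s < b)" and t: "a \<le> t" "t < b"
  shows "\<sigma> t = \<sigma> a"
proof -
  have "\<sigma> constant_on {a..<b}"
  proof (rule locally_constant_imp_constant)
    fix s assume s: "s \<in> {a..<b}"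
    show "\<exists>T. openin (top_of_set {a..<b}) T \<and> s \<in> T \<and> (\<forall>x\<in>T. \<sigma> x = \<sigma> s)"
    proof (cases "s = a")
      case True
      have "\<forall>\<^sub>F r in at_right a. \<sigma> r = \<sigma> a"
        using \<sigma> a by (simp add: piecewise_constant_def)
      then obtain d where d: "d > a" "\<forall>r>a. r < d \<longrightarrow> \<sigma> r = \<sigma> a"
        unfolding eventually_at_right_field by blast
      have "\<forall>x\<in>{a..<b} \<inter> {..<d}. \<sigma> x = \<sigma> a"
      proof
        fix x assume "x \<in> {a..<b} \<inter> {..<d}"
        then have "x = a \<or> (a < x \<and> x < d)" by auto
        then show "\<sigma> x = \<sigma> a" using d(2) by blast
      qed
      moreover have "openin (top_of_set {a..<b}) ({a..<b} \<inter> {..<d})"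
        by (rule openin_open_Int) simp
      moreover have "a \<in> {a..<b} \<inter> {..<d}" using s d(1) by auto
      ultimately show ?thesis unfolding True by blast
    next
      case False
      then have "a < s" "s < b" using s by simp_all
      then have "s \<notin> switching_points \<sigma>" "0 < s" using no [of s] a by auto
      then have "\<forall>\<^sub>F r in nhds s. \<sigma> r = \<sigma> s"
        unfolding switching_points_def by blast
      then obtain U where U: "open U" "s \<in> U" "\<forall>r\<in>U. \<sigma> r = \<sigma> s"
        unfolding eventually_nhds by blast
      have "openin (top_of_set {a..<b}) ({a..<b} \<inter> U)"
        using U(1) by (rule openin_open_Int)
      then show ?thesis
        using s U by blast
    qed
  qed (rule connected_Ico)
  then obtain c where "\<And>r. r \<in> {a..<b} \<Longrightarrow> \<sigma> r = c"
    unfolding constant_on_def by blast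
  then have "\<sigma> t = c" "\<sigma> a = c" using t by simp_all
  then show ?thesis by simp
qed

lemma trajectory_between_switches:
  assumes \<sigma>: "piecewise_constant \<sigma>" and x: "trajectory \<sigma> x" and ab: "0 \<le> a" "a \<le> b"
    and no: "\<And>s. s \<in> switching_points \<sigma> \<Longrightarrow> \<not> (a < s \<and> s < b)"
  shows "x b = matexp ((b - a) *\<^sub>R \<sigma> a) *v x a"
proof (rule matexp_solution_unique [of "{a, b}"])
  show "continuous_on {a..b} x"
    using x ab continuous_on_subset unfolding trajectory_def by fastforce
  fix t assume t: "t \<in> {a..b} - {a, b}"
  then have "\<sigma> t = \<sigma> a"
    by (intro piecewise_constant_constant [OF \<sigma> ab(1) no]) auto
  moreover have "t \<notin> switching_points \<sigma>" using no [of t] t by auto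
  then have "(x has_vector_derivative \<sigma> t *v x t) (at t within {0..})"
    using x t ab by (auto simp: trajectory_def)
  ultimately show "(x has_vector_derivative \<sigma> a *v x t) (at t within {a..b})"
    using has_vector_derivative_within_subset [of x _ t "{0..}" "{a..b}"] ab by auto
qed (use ab in auto)

lemma finite_switching_points:
  assumes "piecewise_constant \<sigma>"
  shows "finite (switching_points \<sigma> \<inter> {0<..t})"
proof (rule finite_subset)
  show "switching_points \<sigma> \<inter> {0<..t} \<subseteq> switching_points \<sigma> \<inter> {0..t}" by auto
qed (use assms in \<open>simp add: piecewise_constant_def\<close>)

text \<open>Induction on the number of switches up to \<open>a\<close>. The stretch from the
  preceding switch, or from 0, to \<open>a\<close> is a complete switching interval, so the dwell
  time condition makes its exponential a letter.\<close>

lemma trajectory_at_switch: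
  assumes \<sigma>: "switching_law \<A> m \<sigma>" and x: "trajectory \<sigma> x"
    and "a \<in> insert 0 (switching_points \<sigma>)" "card (switching_points \<sigma> \<inter> {0<..a}) = k"
  shows "\<exists>M\<in>words (letters \<A> m) k. x a = M *v x 0"
  using assms(3,4)
proof (induction k arbitrary: a)
  case 0
  have pc: "piecewise_constant \<sigma>" using \<sigma> by (simp add: switching_law_def)
  have "switching_points \<sigma> \<inter> {0<..a} = {}"
    using 0 finite_switching_points [OF pc] by auto
  then have "a = 0"
    using 0 by (auto simp: switching_points_def)
  then show ?case by simp
next
  case (Suc k)
  let ?SP = "switching_points \<sigma>"
  have pc: "piecewise_constant \<sigma>" using \<sigma> by (simp add: switching_law_def)
  have "a \<noteq> 0" using Suc.prems(2) by auto
  then have a: "a \<in> ?SP" "a > 0" using Suc.prems(1) by (auto simp: switching_points_def)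
  define B where "B = ?SP \<inter> {0<..<a}"
  have eq: "?SP \<inter> {0<..a} = insert a B" "a \<notin> B" using a by (auto simp: B_def)
  then have B: "finite B" "card B = k"
    using finite_switching_points [OF pc, of a] Suc.prems(2) by auto
  define a' where "a' = Max (insert 0 B)"
  have a'_in: "a' \<in> insert 0 B" unfolding a'_def using B by (intro Max_in) auto
  have a'_max: "s \<le> a'" if "s \<in> B" for s using that B by (simp add: a'_def)
  have a'_bounds: "0 \<le> a'" "a' < a" using a'_in a(2) by (auto simp: B_def)
  have no: "\<not> (a' < s \<and> s < a)" if "s \<in> ?SP" for s
    using a'_max [of s] that a'_bounds by (auto simp: B_def)
  have "?SP \<inter> {0<..a'} = B" using a'_bounds a'_max by (force simp: B_def)
  then obtain M where M: "M \<in> words (letters \<A> m) k" "x a' = M *v x 0"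
    using Suc.IH [of a'] a'_in B by (auto simp: B_def)
  have "switching_interval \<sigma> a' (ereal a)"
    using a'_bounds a'_in a no by (auto simp: switching_interval_def B_def)
  then have "ereal (m (\<sigma> a')) \<le> ereal a - ereal a'"
    using \<sigma> unfolding switching_law_def by blast
  then have "m (\<sigma> a') \<le> a - a'" by simp
  moreover have "\<sigma> a' \<in> \<A>" using \<sigma> a'_bounds by (simp add: switching_law_def)
  ultimately have P: "matexp ((a - a') *\<^sub>R \<sigma> a') \<in> letters \<A> m"
    by (auto simp: letters_def)
  have "x a = matexp ((a - a') *\<^sub>R \<sigma> a') *v x a'"
    using a'_bounds no by (intro trajectory_between_switches [OF pc x]) auto
  then have "x a = (matexp ((a - a') *\<^sub>R \<sigma> a') ** M) *v x 0"
    by (simp add: M matrix_vector_mul_assoc)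
  then show ?case using words_Suc_left [OF M(1) P] by blast
qed

text \<open>The interval in progress at time \<open>t\<close> may not yet have reached its dwell
  time, so its exponential is kept apart from the word.\<close>

lemma trajectory_word:
  assumes \<sigma>: "switching_law \<A> m \<sigma>" and x: "trajectory \<sigma> x" and t: "t \<ge> 0"
  obtains M A r where "M \<in> words (letters \<A> m) (card (switching_points \<sigma> \<inter> {0<..t}))"
    "A \<in> \<A>" "r \<ge> 0" "x t = matexp (r *\<^sub>R A) *v (M *v x 0)"
proof -
  let ?SP = "switching_points \<sigma>"
  have pc: "piecewise_constant \<sigma>" using \<sigma> by (simp add: switching_law_def)
  have fin: "finite (?SP \<inter> {0<..t})" by (rule finite_switching_points [OF pc])
  define a where "a = Max (insert 0 (?SP \<inter> {0<..t}))"
  have a_in: "a \<in> insert 0 (?SP \<inter> {0<..t})" unfolding a_def using fin by (intro Max_in) auto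
  have a_max: "s \<le> a" if "s \<in> ?SP \<inter> {0<..t}" for s using that fin by (simp add: a_def)
  have a: "0 \<le> a" "a \<le> t" using a_in t by auto
  have "?SP \<inter> {0<..a} = ?SP \<inter> {0<..t}" using a a_max by force
  then obtain M where M: "M \<in> words (letters \<A> m) (card (?SP \<inter> {0<..t}))" "x a = M *v x 0"
    using trajectory_at_switch [OF \<sigma> x, of a] a_in by auto
  have "x t = matexp ((t - a) *\<^sub>R \<sigma> a) *v x a"
    using a a_max by (intro trajectory_between_switches [OF pc x]) force+
  moreover have "\<sigma> a \<in> \<A>" using \<sigma> a by (simp add: switching_law_def)
  ultimately show ?thesis
    using a by (intro that [OF M(1)]) (auto simp: M(2))
qed

text \<open>With finitely many switches the last regime, being Hurwitz, decays by itself. With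
  infinitely many, the words describing the trajectory become arbitrarily long.\<close>

lemma trajectory_tendsto_0:
  fixes \<A> :: "(real^'n^'n) set"
  assumes \<sigma>: "switching_law \<A> m \<sigma>" and x: "trajectory \<sigma> x"
    and hur: "\<And>A. A \<in> \<A> \<Longrightarrow> hurwitz A" and m: "\<And>A. A \<in> \<A> \<Longrightarrow> 0 < m A"
    and C: "C \<ge> 1" "\<And>A t x. A \<in> \<A> \<Longrightarrow> t \<ge> 0 \<Longrightarrow> norm (matexp (t *\<^sub>R A) *v x) \<le> C * norm x"
    and half: "\<And>M x. M \<in> words (letters \<A> m) N \<Longrightarrow> norm (M *v x) \<le> norm x / 2"
  shows "(x \<longlongrightarrow> 0) at_top"
proof (cases "finite (switching_points \<sigma>)")
  case True
  have pc: "piecewise_constant \<sigma>" using \<sigma> by (simp add: switching_law_def)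
  define a where "a = Max (insert 0 (switching_points \<sigma>))"
  have a: "0 \<le> a" "\<And>s. s \<in> switching_points \<sigma> \<Longrightarrow> s \<le> a" using True by (auto simp: a_def)
  have "hurwitz (\<sigma> a)" using \<sigma> a hur by (simp add: switching_law_def)
  moreover have "filterlim (\<lambda>t. - a + t) at_top at_top"
    by (rule filterlim_tendsto_add_at_top [OF tendsto_const filterlim_ident])
  ultimately have "((\<lambda>t. matexp ((- a + t) *\<^sub>R \<sigma> a) *v x a) \<longlongrightarrow> 0) at_top"
    by (rule filterlim_compose [OF hurwitz_matexp_mult_tendsto_0])
  then have "((\<lambda>t. matexp ((t - a) *\<^sub>R \<sigma> a) *v x a) \<longlongrightarrow> 0) at_top"
    by simp
  moreover have "\<forall>\<^sub>F t in at_top. matexp ((t - a) *\<^sub>R \<sigma> a) *v x a = x t"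
    using eventually_ge_at_top [of a]
  proof eventually_elim
    case (elim t)
    then show ?case
      using a by (intro trajectory_between_switches [OF pc x, symmetric]) force+
  qed
  ultimately show ?thesis by (rule Lim_transform_eventually)
next
  case False
  have pc: "piecewise_constant \<sigma>" using \<sigma> by (simp add: switching_law_def)
  have bound: "norm (P *v x) \<le> C * norm x" if "P \<in> letters \<A> m" for P x
    using that C(2) m unfolding letters_def by (force intro: less_imp_le less_le_trans)
  show ?thesis
  proof (rule tendstoI)
    fix e :: real assume e: "e > 0"
    \<comment> \<open>The added 1 avoids division by zero for a vanishing initial value and makes
      the final inequality strict.\<close>
    define e' where "e' = e / (C * (norm (x 0) + 1))"
    have pos: "C > 0" "norm (x 0) + 1 > 0" using C(1) by (simp_all add: add_nonneg_pos)
    then have e': "e' > 0" "C * (e' * (norm (x 0) + 1)) = e"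
      using e less_imp_neq [OF pos(2)] by (simp_all add: e'_def)
    have "\<exists>n. \<forall>k\<ge>n. \<forall>M\<in>words (letters \<A> m) k. \<forall>x. norm (M *v x) \<le> e' * norm x"
      by (rule words_decay) (fact bound C(1) half e'(1))+
    then obtain n where
      n: "\<And>k M x. k \<ge> n \<Longrightarrow> M \<in> words (letters \<A> m) k \<Longrightarrow> norm (M *v x) \<le> e' * norm x"
      by blast
    obtain F where F: "finite F" "card F = n" "F \<subseteq> switching_points \<sigma>"
      using infinite_arbitrarily_large [OF False, of n] by auto
    have "norm (x t) < e" if t: "t \<ge> Max (insert 0 F)" for t
    proof -
      have t0: "t \<ge> 0" "\<And>s. s \<in> F \<Longrightarrow> s \<le> t" using t F(1) by auto
      have "F \<subseteq> switching_points \<sigma> \<inter> {0<..t}"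
        using F(3) t0 by (auto simp: switching_points_def)
      then have card: "n \<le> card (switching_points \<sigma> \<inter> {0<..t})"
        using card_mono [OF finite_switching_points [OF pc]] F(2) by blast
      obtain M A r where MAr: "M \<in> words (letters \<A> m) (card (switching_points \<sigma> \<inter> {0<..t}))"
        "A \<in> \<A>" "r \<ge> 0" "x t = matexp (r *\<^sub>R A) *v (M *v x 0)"
        using trajectory_word [OF \<sigma> x t0(1)] by blast
      have "norm (x t) \<le> C * norm (M *v x 0)"
        unfolding MAr(4) by (rule C(2) [OF MAr(2,3)])
      also have "\<dots> \<le> C * (e' * norm (x 0))"
        using n [OF card MAr(1)] C(1) by (intro mult_left_mono) auto
      also have "\<dots> < C * (e' * (norm (x 0) + 1))"
        using C(1) e'(1) by (intro mult_strict_left_mono) auto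
      finally show ?thesis by (simp only: e'(2))
    qed
    then show "\<forall>\<^sub>F t in at_top. dist (x t) 0 < e"
      unfolding eventually_at_top_linorder by (intro exI [of _ "Max (insert 0 F)"]) simp
  qed
qed

section \<open>Switching laws with prescribed regimes and durations\<close>

text \<open>The bound \<delta> prevents the switching times from accumulating, and
  \<open>A_neq\<close> makes each of them a genuine switching point, since only changes of value are
  seen.\<close>

locale switching_sequence =
  fixes A :: "nat \<Rightarrow> real^'n^'n" and s :: "nat \<Rightarrow> real" and \<delta> :: real and y :: "nat \<Rightarrow> real^'n"
  assumes \<delta>: "\<delta> > 0" "\<And>j. \<delta> \<le> s j"
    and A_neq: "\<And>j. A (Suc j) \<noteq> A j"
    and y: "\<And>j. y (Suc j) = matexp (s j *\<^sub>R A j) *v y j"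
begin

definition \<tau> :: "nat \<Rightarrow> real" where
  "\<tau> j = (\<Sum>i<j. s i)"

text \<open>The strict inequality assigns a switching time to the interval that starts there, which
  makes the law constant to the right of every time.\<close>

definition idx :: "real \<Rightarrow> nat" where
  "idx t = (LEAST j. t < \<tau> (Suc j))"

definition law :: "real \<Rightarrow> real^'n^'n" where
  "law t = A (idx t)"

definition state :: "real \<Rightarrow> real^'n" where
  "state t = matexp ((t - \<tau> (idx t)) *\<^sub>R A (idx t)) *v y (idx t)"

lemma \<tau>_0 [simp]: "\<tau> 0 = 0"
  by (simp add: \<tau>_def)

lemma \<tau>_Suc: "\<tau> (Suc j) = \<tau> j + s j"
  by (simp add: \<tau>_def)

lemma s_pos: "s j > 0"
  using \<delta> less_le_trans by blast

lemma strict_mono_\<tau>: "strict_mono \<tau>"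
  unfolding strict_mono_Suc_iff \<tau>_Suc using s_pos by simp

lemma \<tau>_less_iff [simp]: "\<tau> i < \<tau> j \<longleftrightarrow> i < j"
  using strict_mono_\<tau> by (rule strict_mono_less)

lemma \<tau>_le_iff [simp]: "\<tau> i \<le> \<tau> j \<longleftrightarrow> i \<le> j"
  using strict_mono_\<tau> by (rule strict_mono_less_eq)

lemma \<tau>_ge: "real j * \<delta> \<le> \<tau> j"
proof (induction j)
  case (Suc j)
  then show ?case using \<delta>(2) [of j] by (simp add: \<tau>_Suc distrib_right)
qed simp

lemma \<tau>_nonneg: "0 \<le> \<tau> j"
  using \<delta>(1) by (intro order_trans [OF _ \<tau>_ge]) simp

lemma \<tau>_at_top: "filterlim \<tau> at_top sequentially"
proof (rule filterlim_at_top_mono)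
  show "filterlim (\<lambda>j. real j * \<delta>) at_top sequentially"
    using \<delta>(1) by (intro filterlim_at_top_mult_tendsto_pos [OF tendsto_const _ filterlim_real_sequentially])
qed (simp add: \<tau>_ge)

lemma ex_\<tau>_greater: "\<exists>j. t < \<tau> j"
  using \<tau>_at_top eventually_happens' [OF sequentially_bot] unfolding filterlim_at_top_dense by blast

lemma idx:
  assumes "t \<ge> 0"
  shows "\<tau> (idx t) \<le> t" "t < \<tau> (Suc (idx t))"
proof -
  obtain j where j: "t < \<tau> j" using ex_\<tau>_greater by blast
  also have "\<tau> j < \<tau> (Suc j)" by simp
  finally have j': "t < \<tau> (Suc j)" .
  show "t < \<tau> (Suc (idx t))"
    unfolding idx_def by (rule LeastI [of "\<lambda>j. t < \<tau> (Suc j)", OF j'])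
  show "\<tau> (idx t) \<le> t"
  proof (cases "idx t")
    case 0
    then show ?thesis using assms by simp
  next
    case (Suc i)
    then have "\<not> t < \<tau> (Suc i)"
      using not_less_Least [of i "\<lambda>j. t < \<tau> (Suc j)"] by (simp add: idx_def)
    then show ?thesis using Suc by simp
  qed
qed

lemma idx_eq:
  assumes "\<tau> j \<le> t" "t < \<tau> (Suc j)"
  shows "idx t = j"
proof -
  have t: "t \<ge> 0" using \<tau>_nonneg assms(1) by (rule order_trans)
  have "\<tau> j < \<tau> (Suc (idx t))" "\<tau> (idx t) < \<tau> (Suc j)"
    using idx [OF t] assms by linarith+
  then show ?thesis by simp
qed

lemma idx_\<tau> [simp]: "idx (\<tau> j) = j"
  by (rule idx_eq) simp_all

lemma switching_points_law: "switching_points law = \<tau> ` {1..}"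
proof (intro subset_antisym subsetI)
  fix t assume "t \<in> switching_points law"
  then have t: "0 < t" "\<not> (\<forall>\<^sub>F r in nhds t. law r = law t)" by (auto simp: switching_points_def)
  have "\<not> \<tau> (idx t) < t"
  proof
    assume less: "\<tau> (idx t) < t"
    have "\<forall>\<^sub>F r in nhds t. r \<in> {\<tau> (idx t)<..<\<tau> (Suc (idx t))}"
      by (rule eventually_nhds_in_open) (use less idx t in auto)
    then have "\<forall>\<^sub>F r in nhds t. law r = law t"
      by eventually_elim (simp add: law_def idx_eq [of "idx t"])
    with t show False by blast
  qed
  then have eq: "t = \<tau> (idx t)" using idx(1) [of t] t(1) by simp
  then have "idx t \<noteq> 0" using t(1) by (metis \<tau>_0 less_irrefl)
  then show "t \<in> \<tau> ` {1..}" using eq by (intro image_eqI [of _ _ "idx t"]) auto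
next
  fix t assume "t \<in> \<tau> ` {1..}"
  then obtain j where j: "t = \<tau> (Suc j)" by (auto simp: image_iff) (metis One_nat_def Suc_le_D)
  have "\<not> (\<forall>\<^sub>F r in nhds t. law r = law t)"
  proof
    assume "\<forall>\<^sub>F r in nhds t. law r = law t"
    then have "\<forall>\<^sub>F r in at_left t. law r = law t"
      by (simp add: eventually_at_filter eventually_mono)
    moreover have "\<forall>\<^sub>F r in at_left t. r \<in> {\<tau> j<..<t}"
      by (rule eventually_at_leftI [of "\<tau> j"]) (auto simp: j)
    ultimately have "\<forall>\<^sub>F r in at_left t. law r = law t \<and> r \<in> {\<tau> j<..<t}"
      by (rule eventually_conj)
    then obtain r where "law r = law t" "r \<in> {\<tau> j<..<t}"
      using eventually_happens' [OF trivial_limit_at_left_real] by blast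
    moreover from this have "idx r = j" using j by (intro idx_eq) auto
    ultimately show False using A_neq [of j] j by (simp add: law_def)
  qed
  moreover have "0 < t" using j \<tau>_less_iff [of 0 "Suc j"] by simp
  ultimately show "t \<in> switching_points law" by (simp add: switching_points_def)
qed

lemma piecewise_constant_law: "piecewise_constant law"
  unfolding piecewise_constant_def
proof (intro conjI allI impI)
  fix T
  obtain n where n: "T < \<tau> n" using ex_\<tau>_greater by blast
  have "switching_points law \<inter> {0..T} \<subseteq> \<tau> ` {..<n}"
  proof
    fix t assume "t \<in> switching_points law \<inter> {0..T}"
    then obtain j where j: "t = \<tau> j" "t \<le> T" by (auto simp: switching_points_law)
    then have "\<tau> j < \<tau> n" using n by linarith
    then show "t \<in> \<tau> ` {..<n}" using j by simp
  qed
  then show "finite (switching_points law \<inter> {0..T})" by (rule finite_subset) simp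
next
  fix t :: real assume t: "t \<ge> 0"
  show "\<forall>\<^sub>F r in at_right t. law r = law t"
  proof (rule eventually_at_rightI [of t "\<tau> (Suc (idx t))"])
    fix r assume r: "r \<in> {t<..<\<tau> (Suc (idx t))}"
    have "idx r = idx t" using r idx [OF t] by (intro idx_eq) auto
    then show "law r = law t" by (simp add: law_def)
  qed (rule idx [OF t])
qed

text \<open>No interval is unbounded, as every time is followed by a switch; the next switch after
  \<tau> j is the one with index \<open>Suc j\<close>.\<close>

lemma switching_interval_law:
  assumes "switching_interval law a b"
  obtains j where "a = \<tau> j" "law a = A j" "b - ereal a = ereal (s j)"
proof -
  have "a \<in> insert 0 (\<tau> ` {1..})"
    using assms by (simp add: switching_interval_def switching_points_law)
  then obtain j where j: "a = \<tau> j" by (metis \<tau>_0 imageE insert_iff)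
  have no: "\<not> (\<tau> j < \<tau> (Suc i) \<and> ereal (\<tau> (Suc i)) < b)" for i
    using assms j by (auto simp: switching_interval_def switching_points_law)
  have "b = ereal (\<tau> (Suc j))"
  proof -
    have "b \<in> insert \<infinity> (ereal ` \<tau> ` {1..})" "ereal a < b"
      using assms by (auto simp: switching_interval_def switching_points_law)
    moreover have "b \<noteq> \<infinity>" using no [of j] by auto
    ultimately obtain k where k: "b = ereal (\<tau> k)" "j < k" using j by auto
    moreover have "\<not> Suc j < k" using no [of j] k by auto
    ultimately show ?thesis by (metis Suc_lessI)
  qed
  then show ?thesis using that [of j] j by (simp add: law_def \<tau>_Suc)
qed

lemma matexp_shift_has_vector_derivative:
  "((\<lambda>t. matexp ((t - c) *\<^sub>R B) *v v) has_vector_derivative B *v (matexp ((t - c) *\<^sub>R B) *v v)) (at t within S)"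
proof -
  have "((\<lambda>t. t - c) has_vector_derivative 1) (at t within S)"
    by (auto intro!: derivative_eq_intros)
  from vector_diff_chain_within [OF this matexp_mult_has_vector_derivative]
  show ?thesis by (simp add: o_def)
qed

text \<open>At the right end \<open>idx\<close> has already advanced, and the recursion for
  \<open>y\<close> gives the same value. This agreement is the continuity of
  \<open>state\<close>.\<close>

lemma state_on_interval:
  assumes "\<tau> j \<le> t" "t \<le> \<tau> (Suc j)"
  shows "state t = matexp ((t - \<tau> j) *\<^sub>R A j) *v y j"
proof (cases "t = \<tau> (Suc j)")
  case True
  then show ?thesis by (simp add: state_def y) (simp add: \<tau>_Suc)
next
  case False
  then show ?thesis using assms idx_eq by (simp add: state_def)
qed

lemma state_\<tau> [simp]: "state (\<tau> j) = y j"
  by (simp add: state_def)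

lemma continuous_on_state: "continuous_on {0..} state"
proof -
  have cont: "continuous_on {0..\<tau> n} state" for n
  proof (induction n)
    case (Suc n)
    have "continuous_on {\<tau> n..\<tau> (Suc n)} (\<lambda>t. matexp ((t - \<tau> n) *\<^sub>R A n) *v y n)"
      using matexp_shift_has_vector_derivative has_vector_derivative_continuous
      by (fastforce simp: continuous_on_eq_continuous_within)
    then have "continuous_on {\<tau> n..\<tau> (Suc n)} state"
      by (rule continuous_on_eq) (simp add: state_on_interval [of n])
    then have "continuous_on ({0..\<tau> n} \<union> {\<tau> n..\<tau> (Suc n)}) state"
      using Suc by (intro continuous_on_closed_Un) auto
    moreover have "{0..\<tau> n} \<union> {\<tau> n..\<tau> (Suc n)} = {0..\<tau> (Suc n)}"
      using \<tau>_nonneg by (intro ivl_disj_un_two_touch) simp_all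
    ultimately show ?case by simp
  qed simp
  show ?thesis
    unfolding continuous_on_eq_continuous_within
  proof
    fix t :: real assume t: "t \<in> {0..}"
    obtain n where n: "t < \<tau> n" using ex_\<tau>_greater by blast
    have "continuous (at t within {0..\<tau> n}) state"
      using cont t n by (simp add: continuous_on_eq_continuous_within)
    moreover have "at t within {0..\<tau> n} = at t within {0..}"
      by (rule at_within_nhd [of _ "{..<\<tau> n}"]) (use n in auto)
    ultimately show "continuous (at t within {0..}) state" by simp
  qed
qed

lemma trajectory_state: "trajectory law state"
  unfolding trajectory_def
proof (intro conjI allI impI continuous_on_state)
  fix t :: real assume t: "t \<ge> 0" "t \<notin> switching_points law"
  define j where "j = idx t"
  \<comment> \<open>Keeps nearby times inside the current interval. At t = 0 the left distance would
    be zero, but only times to the right are considered there.\<close>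
  define d where "d = (if t = 0 then \<tau> 1 else min (t - \<tau> j) (\<tau> (Suc j) - t))"
  have tj: "\<tau> j \<le> t" "t < \<tau> (Suc j)" using idx [OF t(1)] by (simp_all add: j_def)
  have "t \<noteq> \<tau> j" if "t \<noteq> 0"
    using t(2) that by (cases j) (auto simp: switching_points_law)
  then have d: "d > 0"
    using tj \<tau>_less_iff [of 0 1] by (auto simp: d_def)
  have "state t = matexp ((t - \<tau> j) *\<^sub>R A j) *v y j" using tj by (intro state_on_interval) auto
  moreover have "law t = A j" by (simp add: law_def j_def)
  ultimately have der: "((\<lambda>r. matexp ((r - \<tau> j) *\<^sub>R A j) *v y j) has_vector_derivative law t *v state t) (at t within {0..})"
    using matexp_shift_has_vector_derivative by simp
  show "(state has_vector_derivative law t *v state t) (at t within {0..})"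
  proof (rule has_vector_derivative_transform_within [OF der d])
    show "t \<in> {0..}" using t by simp
    fix r :: real assume r: "r \<in> {0..}" "dist r t < d"
    have "\<tau> j \<le> r \<and> r \<le> \<tau> (Suc j)"
    proof (cases "t = 0")
      case True
      then have "j = 0" using tj(1) \<tau>_le_iff [of j 0] by simp
      with True r show ?thesis by (simp add: d_def dist_real_def)
    next
      case False
      with r show ?thesis by (auto simp: d_def dist_real_def)
    qed
    then show "matexp ((r - \<tau> j) *\<^sub>R A j) *v y j = state r" by (simp add: state_on_interval [of j])
  qed
qed

text \<open>The sequence \<open>y\<close> samples the trajectory at the switching times, which tend
  to infinity.\<close>

lemma tendsto_0_if_J_stable:
  assumes stable: "switching_J_stable J \<A> m"
    and AJ: "\<And>j. A j \<in> \<A>" "\<And>j. restricted_dwell J m (A j) (s j)"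
  shows "y \<longlonglongrightarrow> 0"
proof -
  have "switching_law \<A> m law"
    unfolding switching_law_def
  proof (intro conjI allI impI piecewise_constant_law)
    show "law t \<in> \<A>" for t by (simp add: law_def AJ)
    fix a b assume "switching_interval law a b"
    then obtain j where "law a = A j" "b - ereal a = ereal (s j)"
      using switching_interval_law by blast
    then show "ereal (m (law a)) \<le> b - ereal a"
      using AJ(2) [of j] by (simp add: restricted_dwell_def)
  qed
  moreover have "b - ereal a \<le> ereal (m (law a) + T_cut (law a))"
    if interval: "switching_interval law a b" and "law a \<in> J" for a b
  proof -
    obtain j where "law a = A j" "b - ereal a = ereal (s j)"
      using switching_interval_law [OF interval] by blast
    then show ?thesis
      using AJ(2) [of j] that(2) by (simp add: restricted_dwell_def)
  qed
  ultimately have "(state \<longlongrightarrow> 0) at_top"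
    using stable trajectory_state unfolding switching_J_stable_def by blast
  from filterlim_compose [OF this \<tau>_at_top] show ?thesis by simp
qed

end

theorem theorem1:
  fixes \<A> J :: "(real^'n^'n) set" and m :: "real^'n^'n \<Rightarrow> real"
  assumes "compact \<A>"
    and "\<And>A. A \<in> \<A> \<Longrightarrow> hurwitz A"
    and "\<And>A. A \<in> \<A> \<Longrightarrow> 0 < m A"
    and "0 < (INF A\<in>\<A>. ereal (m A))"
    and "J \<subseteq> \<A>"
    and "switching_J_stable J \<A> m"
  shows "switching_stable \<A> m"
proof -
  have "\<exists>\<delta>>0. \<forall>A\<in>\<A>. \<delta> \<le> m A"
  proof -
    \<comment> \<open>The infimum is an extended real, infinite for empty \<open>\<A>\<close>, so a
      real number strictly below it is taken.\<close>
    obtain \<delta> where \<delta>: "0 < ereal \<delta>" "ereal \<delta> < (INF A\<in>\<A>. ereal (m A))"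
      using ereal_dense2 [OF assms(4)] by blast
    have "\<delta> \<le> m A" if "A \<in> \<A>" for A
      using less_le_trans [OF \<delta>(2) INF_lower [OF that]] by simp
    with \<delta>(1) show ?thesis by auto
  qed
  then obtain \<delta> where \<delta>: "\<delta> > 0" "\<And>A. A \<in> \<A> \<Longrightarrow> \<delta> \<le> m A" by blast
  obtain C where C: "C \<ge> 1" "\<And>A t x. A \<in> \<A> \<Longrightarrow> t \<ge> 0 \<Longrightarrow> norm (matexp (t *\<^sub>R A) *v x) \<le> C * norm x"
  proof (rule compact_hurwitz_matexp_bounded [OF assms(1)])
    show "hurwitz A" if "A \<in> \<A>" for A
      using that by (rule assms(2))
  qed (rule that)
  have stable: "y \<longlonglongrightarrow> 0"
    if seq: "\<And>j. A j \<in> \<A> \<and> restricted_dwell J m (A j) (s j) \<and> A (Suc j) \<noteq> A j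
        \<and> y (Suc j) = matexp (s j *\<^sub>R A j) *v y j" for A s y
  proof -
    have "\<delta> \<le> s j" for j
      using seq [of j] \<delta>(2) [of "A j"] by (simp add: restricted_dwell_def)
    then interpret switching_sequence A s \<delta> y
      by unfold_locales (use \<delta>(1) seq in auto)
    show ?thesis
      using seq by (intro tendsto_0_if_J_stable [OF assms(6)]) auto
  qed
  have "\<exists>N. \<forall>M\<in>words (letters \<A> m) N. \<forall>x. norm (M *v x) \<le> norm x / 2"
  proof (rule restricted_stable_imp_contracting [of \<A> m C J])
    show "hurwitz A" "0 < m A" if "A \<in> \<A>" for A
      using that by (rule assms(2), rule assms(3))
    show "norm (matexp (t *\<^sub>R A) *v x) \<le> C * norm x" if "A \<in> \<A>" "t \<ge> 0" for A t x
      using that by (rule C(2))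
    show "y \<longlonglongrightarrow> 0"
      if "\<And>j. A j \<in> \<A> \<and> restricted_dwell J m (A j) (s j) \<and> A (Suc j) \<noteq> A j
        \<and> y (Suc j) = matexp (s j *\<^sub>R A j) *v y j" for A s y
      using that by (rule stable)
  qed (rule C(1))
  then obtain N where half: "\<And>M x. M \<in> words (letters \<A> m) N \<Longrightarrow> norm (M *v x) \<le> norm x / 2"
    by blast
  show ?thesis
    unfolding switching_stable_def
  proof (intro allI impI, elim conjE)
    fix \<sigma> x assume \<sigma>: "switching_law \<A> m \<sigma>" and x: "trajectory \<sigma> x"
    show "(x \<longlongrightarrow> 0) at_top"
      by (rule trajectory_tendsto_0 [OF \<sigma> x _ _ C(1), of N]) (fact assms C half)+
  qed
qed

end
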